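(* Let $D,d\ge2$, let $|\Psi\rangle$ be the random tensor-network state with bond dimension $D$ and physical dimension $d$ on the $L\times L$ periodic lattice with $L$ sufficiently large (depending on $D,d$), and let $\hat O$ be an arbitrary local observable (Hermitian operator) acting on the physical leg of a single site, with $\mathrm{Tr}(\hat O)=0$. Then for every real $\epsilon>0$, $$\Pr\left[|\langle\Psi|\hat O|\Psi\rangle|\ge\epsilon\right]\le O\left(\frac{\mathrm{Tr}(\hat O^2)\,D^{-4}}{\epsilon^2}\right),$$ where the implied constant is independent of $D$, $\epsilon$, $L$ and $\hat O$.
   Context: Random tensor-network state: the sites are the elements $v=(x,y)$ of $\mathbb{Z}_L\times\mathbb{Z}_L$ (torus, coordinates modulo $L$). To each site attach an independent random unitary $U_v$ on $\mathbb{C}^D\otimes\mathbb{C}^D\otimes\mathbb{C}^d$, distributed according to Haar measure on $U(D^2d)$. Define the site tensor $A^{(v)}_{\alpha,\beta,\gamma,\lambda,j}=\langle\alpha,\beta,0|U_v|\gamma,\lambda,j\rangle$, where $\alpha,\beta,\gamma,\lambda\in\{1,\dots,D\}$ are bond indices, $j\in\{1,\dots,d\}$ is the physical index, and $|0\rangle$ is a fixed unit reference vector of $\mathbb{C}^d$. The index $\gamma$ of site $(x,y)$ is identified with the index $\alpha$ of site $(x,y+1)$, and the index $\lambda$ of site $(x,y)$ with the index $\beta$ of site $(x+1,y)$. The state $|\Psi\rangle\in(\mathbb{C}^d)^{\otimes L^2}$ is $|\Psi\rangle=\sum_{(j_v)}\left(\sum_{\text{bond indices}}\prod_v A^{(v)}\right)|(j_v)_v\rangle$;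 it is not normalized. $\mathrm{Tr}(\hat O^2)$ is the trace over the single-site space $\mathbb{C}^d$. Probability is with respect to the choice of the unitaries. *)

theory Defs
  imports "HOL-Probability.Probability" "Jordan_Normal_Form.Schur_Decomposition"
begin

subsection \<open>Matrices\<close>

definition mat_trace :: "complex mat \<Rightarrow> complex" where
  "mat_trace A = (\<Sum>i<dim_row A. A $$ (i, i))"

definition hermitian_mat :: "complex mat \<Rightarrow> bool" where
  "hermitian_mat A \<longleftrightarrow> mat_adjoint A = A"

definition unitary_group :: "nat \<Rightarrow> complex mat set" where
  "unitary_group n =
     {U \<in> carrier_mat n n. U * mat_adjoint U = 1\<^sub>m n \<and> mat_adjoint U * U = 1\<^sub>m n}"


subsection \<open>Haar measure\<close>

text \<open>The Borel sets of \<open>U(n)\<close> as a subspace of the space of \<open>n \<times> n\<close> complex matrices: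
  the sigma-algebra generated by the matrix entries.\<close>

definition unitary_borel :: "nat \<Rightarrow> complex mat measure" where
  "unitary_borel n = vimage_algebra (unitary_group n)
     (\<lambda>U. \<lambda>p\<in>{..<n} \<times> {..<n}. U $$ p) (\<Pi>\<^sub>M p\<in>{..<n} \<times> {..<n}. borel)"

text \<open>Exactly one measure satisfies this predicate for each \<open>n\<close>; as \<open>U(n)\<close> is compact,
  it is also invariant under multiplication from the right.\<close>

definition haar_unitary :: "nat \<Rightarrow> complex mat measure \<Rightarrow> bool" where
  "haar_unitary n \<mu> \<longleftrightarrow>
     prob_space \<mu> \<and> sets \<mu> = sets (unitary_borel n) \<and>
     (\<forall>V\<in>unitary_group n. distr \<mu> \<mu> (\<lambda>U. V * U) = \<mu>)"


subsection \<open>The random tensor-network state\<close>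

text \<open>Indices are counted from 0.\<close>

type_synonym site = "nat \<times> nat"

definition sites :: "nat \<Rightarrow> site set" where
  "sites L = {..<L} \<times> {..<L}"

text \<open>Position of the basis vector \<open>|a, b, k\<rangle>\<close> of
  \<open>\<complex>\<^sup>D \<otimes> \<complex>\<^sup>D \<otimes> \<complex>\<^sup>d\<close> in the
  lexicographic ordering of the product basis.\<close>

definition tensor_index :: "nat \<Rightarrow> nat \<Rightarrow> nat \<Rightarrow> nat \<Rightarrow> nat \<Rightarrow> nat" where
  "tensor_index D d a b k = (a * D + b) * d + k"

text \<open>\<open>\<langle>\<alpha>, \<beta>, \<phi>| U |\<gamma>, \<lambda>, j\<rangle>\<close>, where \<open>\<phi>\<close> is the reference vector.\<close>

definition site_tensor ::
  "nat \<Rightarrow> nat \<Rightarrow> complex vec \<Rightarrow> complex mat \<Rightarrow> nat \<Rightarrow> nat \<Rightarrow> nat \<Rightarrow> nat \<Rightarrow> nat \<Rightarrow> complex" where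
  "site_tensor D d \<phi> U \<alpha> \<beta> \<gamma> l j =
     (\<Sum>k<d. cnj (\<phi> $ k) * U $$ (tensor_index D d \<alpha> \<beta> k, tensor_index D d \<gamma> l j))"

definition configs :: "nat \<Rightarrow> nat \<Rightarrow> (site \<Rightarrow> nat) set" where
  "configs L m = sites L \<rightarrow>\<^sub>E {..<m}"

text \<open>The amplitude of \<open>|\<Psi>\<rangle>\<close> at the basis state \<open>j\<close>. A bond is labelled by the site at
  which it carries the index \<open>\<alpha>\<close> (in \<open>a\<close>) or \<open>\<beta>\<close> (in \<open>b\<close>); the indices \<open>\<gamma>\<close> and \<open>\<lambda>\<close> of
  \<open>(x, y)\<close> are those of the bonds labelled \<open>(x, y + 1)\<close> and \<open>(x + 1, y)\<close>.\<close>

definition tn_state ::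
  "nat \<Rightarrow> nat \<Rightarrow> nat \<Rightarrow> complex vec \<Rightarrow> (site \<Rightarrow> complex mat) \<Rightarrow> (site \<Rightarrow> nat) \<Rightarrow> complex" where
  "tn_state D d L \<phi> U j =
     (\<Sum>a\<in>configs L D. \<Sum>b\<in>configs L D. \<Prod>(x, y)\<in>sites L.
        site_tensor D d \<phi> (U (x, y)) (a (x, y)) (b (x, y))
          (a (x, (y + 1) mod L)) (b ((x + 1) mod L, y)) (j (x, y)))"

text \<open>The operator on \<open>(\<complex>\<^sup>d)\<^sup>\<otimes>\<^sup>L\<^sup>\<times>\<^sup>L\<close> acting as \<open>Ob\<close> on site \<open>v\<close> and as the identity elsewhere.\<close>

definition apply_at ::
  "nat \<Rightarrow> complex mat \<Rightarrow> site \<Rightarrow> ((site \<Rightarrow> nat) \<Rightarrow> complex) \<Rightarrow> (site \<Rightarrow> nat) \<Rightarrow> complex" where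
  "apply_at d Ob v \<Psi> j = (\<Sum>k<d. Ob $$ (j v, k) * \<Psi> (j(v := k)))"

definition expval ::
  "nat \<Rightarrow> nat \<Rightarrow> complex mat \<Rightarrow> site \<Rightarrow> ((site \<Rightarrow> nat) \<Rightarrow> complex) \<Rightarrow> complex" where
  "expval d L Ob v \<Psi> = (\<Sum>j\<in>configs L d. cnj (\<Psi> j) * apply_at d Ob v \<Psi> j)"

end

theory Submission
  imports Defs "HOL-Real_Asymp.Real_Asymp"
begin

text \<open>The expectation value is real, so by Markov's inequality it suffices to bound the mean of its
  square. Averaging the four copies of each site tensor gives, by the Weingarten formula for \<open>S\<^sub>2\<close>, a sum
  over an input and an output permutation (identity or swap) at each site. Summing out the output
  permutations leaves a model in which \<open>K\<close> is the set of sites in the swap state and the weight of a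
  site depends on its own state and on the states of its upper and right neighbours. These weights are
  nonnegative, a site with two identity neighbours is never in the swap state, and otherwise the two
  weights of a site add up to at most \<open>2/3\<close>, and to at most \<open>3/(2D)\<close> if the neighbours differ.

  As \<open>Tr O = 0\<close>, the site \<open>v\<close> of the observable has nonpositive weight unless it is in the swap state.
  If the antidiagonal containing its two neighbours has no swap site, then \<open>v\<close> contributes
  a factor of order \<open>Tr(O\<^sup>2) / D\<^sup>2\<close>, and each of the two sites depending on \<open>v\<close> a factor of order \<open>1/D\<close>.
  Otherwise the swap sites meet all \<open>L\<close> antidiagonals, and cutting the torus at the antidiagonal
  with the fewest of them shows that the total weight of these configurations vanishes as \<open>L\<close> grows.\<close>

subsection \<open>Percolation along the antidiagonals of the torus\<close>

text \<open>The dependence on neighbours is directed: a step up or right raises \<open>level\<close>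
  by one modulo L. On an acyclic set the sites can be summed out one at a time, each at a factor of
  at most 1. The torus is cyclic, however, and freezing an antidiagonal to break its cycles leaves
  up to 2^L boundary states to be summed over. The two cases pay for them differently. If the
  antidiagonal after v has no swap, that of v can carry no swap except v itself, so a single
  boundary state survives. If the swaps wind around, every swap site is charged a factor 2/3 at the
  site below it. A boundary state A on the sparsest antidiagonal then costs (2/3)^(L |A|), up to one
  lost factor at v, and the sum over nonempty A is (1 + (2/3)^L)^L - 1, roughly L (2/3)^L: the
  exponential cost per swap site beats the number of boundary states. The constant 2/3 is the exact
  weight total at D = d = 2, both for one and for two swap neighbours. How large L must be depends
  on D because the winding term has to drop below D^-4.\<close>

lemma sum_Pow_insert:
  assumes "finite A" "a \<notin> A"
  shows "(\<Sum>K\<in>Pow (insert a A). g K) = (\<Sum>K\<in>Pow A. g K + g (insert a K))"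
proof -
  have inj: "inj_on (insert a) (Pow A)" using assms by (auto simp: inj_on_def)
  have "Pow A \<inter> insert a ` Pow A = {}" using assms by auto
  then have "(\<Sum>K\<in>Pow (insert a A). g K) = (\<Sum>K\<in>Pow A. g K) + (\<Sum>K\<in>insert a ` Pow A. g K)"
    unfolding Pow_insert using assms by (intro sum.union_disjoint) auto
  also have "(\<Sum>K\<in>insert a ` Pow A. g K) = (\<Sum>K\<in>Pow A. g (insert a K))"
    by (subst sum.reindex[OF inj]) simp
  finally show ?thesis by (simp add: sum.distrib)
qed

text \<open>A choice of a boolean at each element is encoded by the set K where it is True. This is
  how one permutation per site becomes a set of swap sites.\<close>

lemma prod_sum_bool:
  fixes g :: "'a \<Rightarrow> bool \<Rightarrow> 'b::comm_semiring_1"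
  assumes "finite A"
  shows "(\<Prod>u\<in>A. \<Sum>b\<in>UNIV. g u b) = (\<Sum>K\<in>Pow A. \<Prod>u\<in>A. g u (u \<in> K))"
  using assms
proof (induction A)
  case (insert a A)
  have "(\<Sum>K\<in>Pow (insert a A). \<Prod>u\<in>insert a A. g u (u \<in> K)) =
    (\<Sum>K\<in>Pow A. (\<Prod>u\<in>insert a A. g u (u \<in> K)) + (\<Prod>u\<in>insert a A. g u (u \<in> insert a K)))"
    using insert by (intro sum_Pow_insert) auto
  also have "\<dots> = (\<Sum>K\<in>Pow A. (\<Sum>b\<in>UNIV. g a b) * (\<Prod>u\<in>A. g u (u \<in> K)))"
  proof (intro sum.cong refl)
    fix K assume "K \<in> Pow A"
    then have "a \<notin> K" using insert by auto
    have "(\<Prod>u\<in>A. g u (u \<in> insert a K)) = (\<Prod>u\<in>A. g u (u \<in> K))"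
    proof (intro prod.cong refl)
      fix u assume "u \<in> A"
      then have "u \<noteq> a" using insert by auto
      then show "g u (u \<in> insert a K) = g u (u \<in> K)" by simp
    qed
    then show "(\<Prod>u\<in>insert a A. g u (u \<in> K)) + (\<Prod>u\<in>insert a A. g u (u \<in> insert a K)) =
      (\<Sum>b\<in>UNIV. g a b) * (\<Prod>u\<in>A. g u (u \<in> K))"
      using insert \<open>a \<notin> K\<close> by (simp add: UNIV_bool algebra_simps)
  qed
  finally show ?case using insert by (simp add: sum_distrib_left)
qed simp

lemma sum_power_card_Pow:
  fixes q :: real
  assumes "finite A"
  shows "(\<Sum>K\<in>Pow A. q ^ card K) = (1 + q) ^ card A"
  using prod_add[OF assms, of "\<lambda>_. q" "\<lambda>_. 1"] by (simp add: add.commute)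

text \<open>Sum over the element of highest rank first: no other factor depends on it.\<close>

lemma sum_acyclic_le_1:
  fixes f :: "'a \<Rightarrow> bool \<Rightarrow> bool \<Rightarrow> bool \<Rightarrow> real" and rk :: "'a \<Rightarrow> nat"
  assumes "finite R" "R \<inter> B = {}"
    and "\<And>u. u \<in> R \<Longrightarrow> m u \<in> R \<Longrightarrow> rk (m u) < rk u"
    and "\<And>u. u \<in> R \<Longrightarrow> n u \<in> R \<Longrightarrow> rk (n u) < rk u"
    and "\<And>u b p q. u \<in> R \<Longrightarrow> 0 \<le> f u b p q"
    and "\<And>u p q. u \<in> R \<Longrightarrow> f u True p q + f u False p q \<le> 1"
  shows "(\<Sum>K\<in>Pow R. \<Prod>u\<in>R. f u (u \<in> K \<union> B) (m u \<in> K \<union> B) (n u \<in> K \<union> B)) \<le> 1"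
  using assms
proof (induction "card R" arbitrary: R)
  case 0
  then show ?case by simp
next
  case (Suc k)
  then have "R \<noteq> {}" by auto
  then have "Max (rk ` R) \<in> rk ` R" using Suc.prems(1) by (intro Max_in) auto
  then obtain a where a: "a \<in> R" and rka: "rk a = Max (rk ` R)" by auto
  have max: "rk u \<le> rk a" if "u \<in> R" for u
    using that Suc.prems(1) by (simp add: rka)
  define R' where "R' = R - {a}"
  have R: "R = insert a R'" "a \<notin> R'" "finite R'" "R' \<inter> B = {}" "a \<notin> B"
    using a Suc.prems by (auto simp: R'_def)
  \<comment> \<open>Since a has maximal rank in R, no element of R, a included, has a as a
    neighbour; so only the factor at a sees whether a is in K.\<close>
  have nomn: "m u \<noteq> a" "n u \<noteq> a" if "u \<in> R" for u
    using Suc.prems(3)[OF that] Suc.prems(4)[OF that] a max[OF that] by auto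
  let ?P = "\<lambda>K. \<Prod>u\<in>R'. f u (u \<in> K \<union> B) (m u \<in> K \<union> B) (n u \<in> K \<union> B)"
  have "(\<Sum>K\<in>Pow R. \<Prod>u\<in>R. f u (u \<in> K \<union> B) (m u \<in> K \<union> B) (n u \<in> K \<union> B)) =
     (\<Sum>K\<in>Pow R'. (\<Prod>u\<in>R. f u (u \<in> K \<union> B) (m u \<in> K \<union> B) (n u \<in> K \<union> B))
       + (\<Prod>u\<in>R. f u (u \<in> insert a K \<union> B) (m u \<in> insert a K \<union> B) (n u \<in> insert a K \<union> B)))"
    unfolding R(1) using R by (intro sum_Pow_insert) auto
  also have "\<dots> = (\<Sum>K\<in>Pow R'. ?P K * (f a False (m a \<in> K \<union> B) (n a \<in> K \<union> B)
      + f a True (m a \<in> K \<union> B) (n a \<in> K \<union> B)))"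
  proof (intro sum.cong refl)
    fix K assume K: "K \<in> Pow R'"
    have 1: "(\<Prod>u\<in>R'. f u (u \<in> insert a K \<union> B) (m u \<in> insert a K \<union> B) (n u \<in> insert a K \<union> B)) = ?P K"
    proof (intro prod.cong refl)
      fix u assume "u \<in> R'"
      then have "u \<noteq> a" "m u \<noteq> a" "n u \<noteq> a" using nomn[of u] R by auto
      then show "f u (u \<in> insert a K \<union> B) (m u \<in> insert a K \<union> B) (n u \<in> insert a K \<union> B) =
        f u (u \<in> K \<union> B) (m u \<in> K \<union> B) (n u \<in> K \<union> B)" by simp
    qed
    have "a \<notin> K \<union> B" using R K by auto
    then have 2: "(\<Prod>u\<in>R. f u (u \<in> K \<union> B) (m u \<in> K \<union> B) (n u \<in> K \<union> B)) =
        f a False (m a \<in> K \<union> B) (n a \<in> K \<union> B) * ?P K"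
      by (simp only: R(1) prod.insert[OF R(3) R(2)])
    have 3: "(\<Prod>u\<in>R. f u (u \<in> insert a K \<union> B) (m u \<in> insert a K \<union> B) (n u \<in> insert a K \<union> B)) =
        f a True (m a \<in> K \<union> B) (n a \<in> K \<union> B) * ?P K"
      unfolding R(1) prod.insert[OF R(3) R(2)] 1 using nomn[OF a] by simp
    show "(\<Prod>u\<in>R. f u (u \<in> K \<union> B) (m u \<in> K \<union> B) (n u \<in> K \<union> B))
       + (\<Prod>u\<in>R. f u (u \<in> insert a K \<union> B) (m u \<in> insert a K \<union> B) (n u \<in> insert a K \<union> B))
       = ?P K * (f a False (m a \<in> K \<union> B) (n a \<in> K \<union> B) + f a True (m a \<in> K \<union> B) (n a \<in> K \<union> B))"
      unfolding 2 3 by (metis (no_types) distrib_right mult.commute)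
  qed
  also have "\<dots> \<le> (\<Sum>K\<in>Pow R'. ?P K * 1)"
  proof (intro sum_mono mult_left_mono prod_nonneg ballI)
    show "f a False p q + f a True p q \<le> 1" for p q
      using Suc.prems(6)[OF a, of p q] by simp
    show "0 \<le> f u b p q" if "u \<in> R'" for u b p q
      using Suc.prems(5) that R(1) by blast
  qed
  also have "\<dots> = (\<Sum>K\<in>Pow R'. ?P K)" by simp
  also have "\<dots> \<le> 1"
  proof (rule Suc.hyps(1))
    show "k = card R'" using Suc.hyps(2) R(1-3) by simp
    have sub: "u \<in> R" if "u \<in> R'" for u using that R(1) by simp
    show "rk (m u) < rk u" if "u \<in> R'" "m u \<in> R'" for u using Suc.prems(3) that sub by blast
    show "rk (n u) < rk u" if "u \<in> R'" "n u \<in> R'" for u using Suc.prems(4) that sub by blast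
    show "0 \<le> f u b p q" if "u \<in> R'" for u b p q using Suc.prems(5) that sub by blast
    show "f u True p q + f u False p q \<le> 1" if "u \<in> R'" for u p q using Suc.prems(6) that sub by blast
    show "finite R'" "R' \<inter> B = {}" by (fact R)+
  qed
  finally show ?case .
qed

section \<open>Neighbours and antidiagonals of the torus\<close>

definition up :: "nat \<Rightarrow> site \<Rightarrow> site" where
  "up L = (\<lambda>(x, y). (x, (y + 1) mod L))"

definition right :: "nat \<Rightarrow> site \<Rightarrow> site" where
  "right L = (\<lambda>(x, y). ((x + 1) mod L, y))"

lemma finite_sites [simp]: "finite (sites L)"
  by (simp add: sites_def)

lemma bij_Suc_mod: fixes L :: nat shows "bij_betw (\<lambda>x. (x + 1) mod L) {..<L} {..<L}"
proof (rule bij_betw_imageI)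
  show inj: "inj_on (\<lambda>x. (x + 1) mod L) {..<L}"
    unfolding inj_on_def
  proof (intro ballI impI)
    fix x y assume "x \<in> {..<L}" "y \<in> {..<L}" "(x + 1) mod L = (y + 1) mod L"
    then show "x = y" by (cases "x + 1 = L"; cases "y + 1 = L") auto
  qed
  show "(\<lambda>x. (x + 1) mod L) ` {..<L} = {..<L}"
    by (rule endo_inj_surj) (use inj in auto)
qed

lemma bij_up: "bij_betw (up L) (sites L) (sites L)"
  using bij_betw_map_prod[OF bij_betw_id[of "{..<L}"] bij_Suc_mod[of L]]
  by (simp add: up_def sites_def map_prod_def)

lemma bij_right: "bij_betw (right L) (sites L) (sites L)"
  using bij_betw_map_prod[OF bij_Suc_mod[of L] bij_betw_id[of "{..<L}"]]
  by (simp add: right_def sites_def map_prod_def)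

lemma up_in_sites: "u \<in> sites L \<Longrightarrow> up L u \<in> sites L"
  using bij_up bij_betwE by blast

lemma right_in_sites: "u \<in> sites L \<Longrightarrow> right L u \<in> sites L"
  using bij_right bij_betwE by blast

definition level :: "nat \<Rightarrow> site \<Rightarrow> nat" where
  "level L u = (fst u + snd u) mod L"

lemma level_up: "level L (up L u) = (level L u + 1) mod L"
  by (cases u) (simp add: level_def up_def mod_simps)

lemma level_right: "level L (right L u) = (level L u + 1) mod L"
  by (cases u) (simp add: level_def right_def mod_simps)

definition slice :: "nat \<Rightarrow> nat \<Rightarrow> site set" where
  "slice L t = {u \<in> sites L. level L u = t}"

lemma card_slice:
  assumes "t < L" shows "card (slice L t) = L"
proof -
  have "slice L t = (\<lambda>x. (x, (t + L - x) mod L)) ` {..<L}"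
  proof (intro equalityI subsetI)
    fix u assume "u \<in> slice L t"
    then obtain x y where u: "u = (x, y)" "x < L" "y < L" "(x + y) mod L = t"
      by (auto simp: slice_def level_def sites_def)
    have "(t + L - x) mod L = y"
    proof (cases "x + y < L")
      case True
      then have "t + L - x = y + L" using u by simp
      then show ?thesis using u by simp
    next
      case False
      then have "x + y - L < L" using u by linarith
      then have "(x + y) mod L = x + y - L" using False by (simp add: le_mod_geq)
      then have "t + L - x = y" using u False by linarith
      then show ?thesis using u by simp
    qed
    then show "u \<in> (\<lambda>x. (x, (t + L - x) mod L)) ` {..<L}" using u by auto
  next
    fix u assume "u \<in> (\<lambda>x. (x, (t + L - x) mod L)) ` {..<L}"
    then obtain x where u: "u = (x, (t + L - x) mod L)" "x < L" by auto
    have "(x + (t + L - x) mod L) mod L = t"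
      using u assms by (simp add: mod_simps)
    then show "u \<in> slice L t" using u by (auto simp: slice_def level_def sites_def)
  qed
  then show ?thesis by (simp add: card_image inj_on_def)
qed

text \<open>The number of steps up or right, between 1 and L, that lead from u to antidiagonal t; on
  t itself it is L, a full turn.\<close>

definition slice_rank :: "nat \<Rightarrow> nat \<Rightarrow> site \<Rightarrow> nat" where
  "slice_rank L t u = (if level L u < t then t - level L u else t + L - level L u)"

lemma slice_rank_less:
  assumes "t < L" "level L u' = (level L u + 1) mod L" "level L u \<noteq> t" "level L u' \<noteq> t"
  shows "slice_rank L t u' < slice_rank L t u"
proof -
  have "level L u < L" using assms by (simp add: level_def)
  then show ?thesis using assms by (auto simp: slice_rank_def mod_if split: if_splits)
qed

lemma sum_off_slice_le_1:
  fixes f :: "site \<Rightarrow> bool \<Rightarrow> bool \<Rightarrow> bool \<Rightarrow> real"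
  assumes "R \<subseteq> sites L - slice L t" "t < L" "R \<inter> B = {}"
    and "\<And>u b p q. 0 \<le> f u b p q" "\<And>u p q. f u True p q + f u False p q \<le> 1"
  shows "(\<Sum>K\<in>Pow R. \<Prod>u\<in>R. f u (u \<in> K \<union> B) (up L u \<in> K \<union> B) (right L u \<in> K \<union> B)) \<le> 1"
proof (rule sum_acyclic_le_1[where rk = "slice_rank L t"])
  show "finite R" using assms(1) finite_subset[OF _ finite_sites[of L]] by auto
  show "slice_rank L t (up L u) < slice_rank L t u" if "u \<in> R" "up L u \<in> R" for u
    using that assms(1) by (intro slice_rank_less[OF assms(2) level_up]) (auto simp: slice_def)
  show "slice_rank L t (right L u) < slice_rank L t u" if "u \<in> R" "right L u \<in> R" for u
    using that assms(1) by (intro slice_rank_less[OF assms(2) level_right]) (auto simp: slice_def)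
qed (rule assms(3-5))+

lemma sum_Pow_Un_disjoint:
  assumes "finite A" "finite B" "A \<inter> B = {}"
  shows "(\<Sum>K\<in>Pow (A \<union> B). g K) = (\<Sum>X\<in>Pow A. \<Sum>Y\<in>Pow B. g (X \<union> Y))"
proof -
  have "(\<Sum>(X, Y)\<in>Pow A \<times> Pow B. g (X \<union> Y)) = (\<Sum>K\<in>Pow (A \<union> B). g K)"
    by (rule sum.reindex_bij_witness[of _ "\<lambda>K. (K \<inter> A, K \<inter> B)" "\<lambda>(X, Y). X \<union> Y"])
      (use assms in auto)
  then show ?thesis by (simp add: sum.cartesian_product)
qed

text \<open>In \<open>w b p q\<close>, the state of a site is \<open>b\<close> and the states of its upper and right neighbours are
  \<open>p\<close> and \<open>q\<close>; swap is \<open>True\<close>.\<close>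

locale percolation =
  fixes L :: nat and w :: "bool \<Rightarrow> bool \<Rightarrow> bool \<Rightarrow> real" and \<kappa> :: real
  assumes L: "L \<ge> 3"
    and w_nonneg: "\<And>b p q. 0 \<le> w b p q"
    and w_birth: "w True False False = 0" "w False False False = 1"
    and w_sum: "\<And>p q. p \<or> q \<Longrightarrow> w True p q + w False p q \<le> 2/3"
    and w_mixed: "\<And>p q. p \<noteq> q \<Longrightarrow> w True p q + w False p q \<le> \<kappa>"
    and \<kappa>: "\<kappa> > 0"
begin

abbreviation "S \<equiv> sites L"

definition weight :: "site \<Rightarrow> site set \<Rightarrow> real" where
  "weight u K = w (u \<in> K) (up L u \<in> K) (right L u \<in> K)"

lemma weight_nonneg: "0 \<le> weight u K"
  by (simp add: weight_def w_nonneg)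

lemma w_total: "w True p q + w False p q \<le> 1"
  using w_sum[of p q] w_birth by (cases "p \<or> q") auto

lemma w_le_1: "w b p q \<le> 1"
  using w_total[of p q] w_nonneg[of True p q] w_nonneg[of False p q] by (cases b) auto

lemma weight_le_1: "weight u K \<le> 1"
  by (simp add: weight_def w_le_1)

lemma level_less: "level L u < L"
  using L by (simp add: level_def)

text \<open>A swap site on the antidiagonal of v other than v would have two identity neighbours and
  weight 0. Hence this antidiagonal is frozen with v as its only swap, and the rest can be summed
  out. The sites below and to the left of v each see exactly one swap neighbour, which yields the
  two factors \<kappa>.\<close>

lemma sum_weight_dead:
  assumes v: "v \<in> S"
  shows "(\<Sum>K\<in>{K \<in> Pow S. v \<in> K \<and> K \<inter> slice L ((level L v + 1) mod L) = {}}.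
      \<Prod>u\<in>S - {v}. weight u K) \<le> \<kappa>\<^sup>2"
proof -
  define t where "t = level L v"
  define P where "P = slice L ((t + 1) mod L)"
  define R where "R = S - (P \<union> slice L t)"
  define \<K> where "\<K> = {K \<in> Pow S. v \<in> K \<and> K \<inter> P = {}}"
  have tL: "t < L" by (simp add: t_def level_less)
  have tt: "(t + 1) mod L \<noteq> t" using tL L by (auto simp: mod_if)
  have vt: "v \<in> slice L t" using v by (simp add: slice_def t_def)
  have vP: "v \<notin> P" using tt by (simp add: slice_def t_def P_def)
  have R: "R \<subseteq> S - slice L t" "v \<notin> R" "finite R" "R \<subseteq> S - {v}"
    using vt finite_subset[of R S] by (auto simp: R_def)
  obtain a where a: "a \<in> S" "up L a = v" using bij_betw_imp_surj_on[OF bij_up[of L]] v by (metis imageE)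
  obtain b where b: "b \<in> S" "right L b = v" using bij_betw_imp_surj_on[OF bij_right[of L]] v by (metis imageE)
  have la: "(level L a + 1) mod L = t" using level_up[of L a] a by (simp add: t_def)
  have lb: "(level L b + 1) mod L = t" using level_right[of L b] b by (simp add: t_def)
  \<comment> \<open>Here L >= 3 is essential: the antidiagonal just before that of v must differ
    from the one just after it, so that a and b lie in R.\<close>
  have nt: "l \<noteq> t \<and> l \<noteq> (t + 1) mod L" if "(l + 1) mod L = t" "l < L" for l
    using that L tL by (cases "l + 1 = L"; cases "t + 1 = L") auto
  have aR: "a \<in> R" and bR: "b \<in> R"
    using nt[OF la level_less] nt[OF lb level_less] a(1) b(1)
    by (auto simp: R_def P_def slice_def)
  have neq: "up L u \<noteq> right L u" if "u \<in> S" for u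
    using that L by (auto simp: up_def right_def sites_def mod_if split: if_splits)
  have ab: "a \<noteq> b" using neq[OF a(1)] a b by metis
  \<comment> \<open>At a and b the weight is divided by \<kappa> and cut off outside the mixed
    pattern, the only one that occurs there. The totals stay at most 1 and a factor \<kappa> is
    released at each of the two sites.\<close>
  define f where "f u x p q = (if u \<in> {a, b} then (if p \<noteq> q then w x p q / \<kappa> else 0) else w x p q)"
    for u x p q
  have f0: "0 \<le> f u x p q" for u x p q using w_nonneg \<kappa> by (simp add: f_def)
  have f1: "f u True p q + f u False p q \<le> 1" for u p q
    using w_mixed[of p q] w_total[of p q] \<kappa>
    by (auto simp: f_def add_divide_distrib[symmetric] divide_le_eq)
  have "(\<Sum>K\<in>\<K>. \<Prod>u\<in>S - {v}. weight u K) =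
      (\<Sum>K\<in>insert v ` Pow R. \<Prod>u\<in>S - {v}. weight u K)"
  proof (rule sum.mono_neutral_right)
    show "finite \<K>" by (simp add: \<K>_def)
    show "insert v ` Pow R \<subseteq> \<K>" using R vP v by (auto simp: \<K>_def R_def)
    show "\<forall>K\<in>\<K> - insert v ` Pow R. (\<Prod>u\<in>S - {v}. weight u K) = 0"
    proof
      fix K assume K: "K \<in> \<K> - insert v ` Pow R"
      then have K': "K \<subseteq> S" "v \<in> K" "K \<inter> P = {}" by (auto simp: \<K>_def)
      have "\<exists>u\<in>slice L t. u \<in> K \<and> u \<noteq> v"
      proof (rule ccontr)
        assume "\<not> ?thesis"
        then have "K - {v} \<in> Pow R" "insert v (K - {v}) = K" using K' by (auto simp: R_def)
        then show False using K by (metis DiffD2 image_eqI)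
      qed
      then obtain u where u: "u \<in> slice L t" "u \<in> K" "u \<noteq> v" by blast
      then have uS: "u \<in> S" "level L u = t" by (auto simp: slice_def)
      then have "up L u \<in> P" "right L u \<in> P"
        by (auto simp: P_def slice_def level_up level_right up_in_sites right_in_sites)
      then have "up L u \<notin> K" "right L u \<notin> K" using K'(3) by auto
      then have "weight u K = 0" using u w_birth by (simp add: weight_def)
      then show "(\<Prod>u\<in>S - {v}. weight u K) = 0" using u uS by (intro prod_zero) auto
    qed
  qed
  also have "\<dots> = (\<Sum>K\<in>Pow R. \<Prod>u\<in>S - {v}. weight u (insert v K))"
    using R by (subst sum.reindex) (auto simp: inj_on_def)
  also have "\<dots> \<le> (\<Sum>K\<in>Pow R. \<kappa>\<^sup>2 * (\<Prod>u\<in>R. f u (u \<in> K \<union> {v}) (up L u \<in> K \<union> {v}) (right L u \<in> K \<union> {v})))"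
  proof (intro sum_mono)
    fix K assume "K \<in> Pow R"
    then have K: "K \<subseteq> R" by simp
    \<comment> \<open>The factors on the two frozen antidiagonals are at most 1 and are
      discarded.\<close>
    have "(\<Prod>u\<in>S - {v}. weight u (insert v K)) =
        (\<Prod>u\<in>S - {v} - R. weight u (insert v K)) * (\<Prod>u\<in>R. weight u (insert v K))"
      using R by (intro prod.subset_diff) auto
    also have "\<dots> \<le> 1 * (\<Prod>u\<in>R. weight u (insert v K))"
      by (intro mult_right_mono prod_le_1 prod_nonneg) (auto simp: weight_nonneg weight_le_1)
    also have "\<dots> = (\<Prod>u\<in>R. (if u \<in> {a, b} then \<kappa> else 1) *
        f u (u \<in> K \<union> {v}) (up L u \<in> K \<union> {v}) (right L u \<in> K \<union> {v}))"
      unfolding mult_1_left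
    proof (intro prod.cong refl)
      fix u assume u: "u \<in> R"
      have *: "r = v" if "r \<in> insert v K" "r \<in> slice L t" for r
        using that K by (auto simp: R_def)
      have "(up L u \<in> insert v K) \<noteq> (right L u \<in> insert v K)" if "u \<in> {a, b}"
      proof -
        have "u \<in> S" "(level L u + 1) mod L = t" using that a b la lb by auto
        then have "up L u \<in> slice L t" "right L u \<in> slice L t"
          by (auto simp: slice_def level_up level_right up_in_sites right_in_sites)
        then show ?thesis using * neq[OF \<open>u \<in> S\<close>] that a b by (metis empty_iff insert_iff)
      qed
      then show "weight u (insert v K) = (if u \<in> {a, b} then \<kappa> else 1) *
        f u (u \<in> K \<union> {v}) (up L u \<in> K \<union> {v}) (right L u \<in> K \<union> {v})"
        using \<kappa> by (auto simp: f_def weight_def)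
    qed
    also have "\<dots> = (\<Prod>u\<in>R. if u \<in> {a, b} then \<kappa> else 1) *
        (\<Prod>u\<in>R. f u (u \<in> K \<union> {v}) (up L u \<in> K \<union> {v}) (right L u \<in> K \<union> {v}))"
      by (rule prod.distrib)
    also have "(\<Prod>u\<in>R. if u \<in> {a, b} then \<kappa> else 1) = (\<Prod>u\<in>{a, b}. \<kappa>)"
      using aR bR R by (intro prod.mono_neutral_cong_right) auto
    also have "\<dots> = \<kappa>\<^sup>2" using ab by (simp add: power2_eq_square)
    finally show "(\<Prod>u\<in>S - {v}. weight u (insert v K)) \<le>
      \<kappa>\<^sup>2 * (\<Prod>u\<in>R. f u (u \<in> K \<union> {v}) (up L u \<in> K \<union> {v}) (right L u \<in> K \<union> {v}))" .
  qed
  also have "\<dots> = \<kappa>\<^sup>2 * (\<Sum>K\<in>Pow R. \<Prod>u\<in>R. f u (u \<in> K \<union> {v}) (up L u \<in> K \<union> {v}) (right L u \<in> K \<union> {v}))"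
    by (simp add: sum_distrib_left)
  also have "\<dots> \<le> \<kappa>\<^sup>2 * 1"
    by (intro mult_left_mono sum_off_slice_le_1[OF R(1) tL] f0 f1) (use R in auto)
  finally show ?thesis by (simp add: \<K>_def P_def t_def)
qed

text \<open>With nonzero weight, a swap site other than v has a swap neighbour on the next
  antidiagonal. Starting after v, swaps are therefore passed on from one antidiagonal to the next
  all the way round.\<close>

lemma slices_nonempty:
  assumes v: "v \<in> S" and K: "K \<subseteq> S" "v \<in> K" "K \<inter> slice L ((level L v + 1) mod L) \<noteq> {}"
    and nz: "(\<Prod>u\<in>S - {v}. weight u K) \<noteq> 0" and t: "t < L"
  shows "K \<inter> slice L t \<noteq> {}"
proof -
  have step: "\<exists>u'\<in>K. level L u' = (level L u + 1) mod L" if "u \<in> K" "u \<noteq> v" for u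
  proof -
    have "weight u K \<noteq> 0" using nz that K by (auto simp: prod_zero_iff)
    then have "up L u \<in> K \<or> right L u \<in> K" using that w_birth by (cases "up L u \<in> K"; cases "right L u \<in> K") (auto simp: weight_def)
    then show ?thesis using level_up level_right by metis
  qed
  have main: "\<exists>u\<in>K. level L u = (level L v + 1 + k) mod L" for k
  proof (induction k)
    case 0
    then show ?case using K by (auto simp: slice_def)
  next
    case (Suc k)
    then obtain u where u: "u \<in> K" "level L u = (level L v + 1 + k) mod L" by auto
    show ?case
    proof (cases "u = v")
      case True
      \<comment> \<open>The weight of v is not in the product, so v need not have a swap neighbour;
        the assumed swap on the next antidiagonal continues the chain instead.\<close>
      obtain u' where "u' \<in> K" "level L u' = (level L v + 1) mod L"
        using K by (auto simp: slice_def)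
      moreover have "(level L v + 1 + Suc k) mod L = ((level L v + 1 + k) mod L + 1) mod L"
        by (simp add: mod_simps)
      ultimately show ?thesis using u True by metis
    next
      case False
      have "(level L v + 1 + Suc k) mod L = ((level L v + 1 + k) mod L + 1) mod L"
        by (simp add: mod_simps)
      then show ?thesis using step[OF u(1) False] u by metis
    qed
  qed
  have "level L v + 1 + (t + L - (level L v + 1)) = t + L"
    using level_less[of v] by simp
  then have "(level L v + 1 + (t + L - (level L v + 1))) mod L = t" using t by simp
  then obtain u where "u \<in> K" "level L u = t" using main by metis
  then show ?thesis using K by (auto simp: slice_def)
qed

text \<open>Each K is charged to an antidiagonal with the fewest swap sites, and the minimum is
  bounded by the sum over all antidiagonals, whence the factor L. Given the state A of that
  antidiagonal, the other sites sum to at most 1, while A carries (2/3)^(L |A|). The factor 3/2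
  restores the one power of 2/3 that cannot be collected at v.\<close>

lemma sum_weight_winding:
  assumes v: "v \<in> S"
  shows "(\<Sum>K\<in>{K \<in> Pow S. v \<in> K \<and> K \<inter> slice L ((level L v + 1) mod L) \<noteq> {}}.
      \<Prod>u\<in>S - {v}. weight u K) \<le> 3/2 * real L * ((1 + (2/3) ^ L) ^ L - 1)"
proof -
  define q :: real where "q = 2/3"
  \<comment> \<open>The weights are rescaled by 3/2 wherever a swap neighbour exists, which
    \<open>w_sum\<close> allows without the totals exceeding 1. The site v has no weight here, and
    its factor only enforces that v is in K.\<close>
  define f where "f u x p r = (if u = v then of_bool x else w x p r * (if p \<or> r then 3/2 else 1))"
    for u x p r
  define F where "F u K = f u (u \<in> K) (up L u \<in> K) (right L u \<in> K)" for u K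
  \<comment> \<open>The value 0 at the empty set records that every antidiagonal is met; without it
    the final sum would not tend to 0.\<close>
  define g where "g A = (if A = {} then 0 else (q ^ L) ^ card A)" for A :: "site set"
  define \<K> where "\<K> = {K \<in> Pow S. v \<in> K \<and> K \<inter> slice L ((level L v + 1) mod L) \<noteq> {}}"
  have f0: "0 \<le> f u x p r" for u x p r using w_nonneg by (simp add: f_def)
  have fsum: "f u True p r + f u False p r \<le> 1" for u p r
    using w_sum[of p r] w_birth by (cases "p \<or> r") (auto simp: f_def)
  have f1: "f u x p r \<le> 1" for u x p r
    using fsum[of u p r] f0[of u True p r] f0[of u False p r] by (cases x) auto
  have F0: "0 \<le> F u K" and F1: "F u K \<le> 1" for u K by (auto simp: F_def f0 f1)
  have g0: "0 \<le> g A" for A by (simp add: g_def q_def)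
  have term_le: "(\<Prod>u\<in>S - {v}. weight u K) \<le>
      3/2 * (\<Sum>t<L. g (K \<inter> slice L t) * (\<Prod>u\<in>S. F u K))" if "K \<in> \<K>" for K
  proof (cases "(\<Prod>u\<in>S - {v}. weight u K) = 0")
    case True
    show ?thesis unfolding True
      by (intro mult_nonneg_nonneg sum_nonneg prod_nonneg ballI g0 F0) simp
  next
    case False
    have K: "K \<subseteq> S" "v \<in> K" "K \<inter> slice L ((level L v + 1) mod L) \<noteq> {}"
      using that by (auto simp: \<K>_def)
    then have "finite K" by (simp add: finite_subset[OF K(1)])
    have ne: "K \<inter> slice L t \<noteq> {}" if "t < L" for t
      by (rule slices_nonempty[OF v K False that])
    obtain s where s: "s < L" "\<And>t. t < L \<Longrightarrow> card (K \<inter> slice L s) \<le> card (K \<inter> slice L t)"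
    proof -
      have "{..<L} \<noteq> {}" using L by (simp add: lessThan_empty_iff)
      then obtain s where "is_arg_min (\<lambda>t. card (K \<inter> slice L t)) (\<lambda>t. t \<in> {..<L}) s"
        using ex_is_arg_min_if_finite[of "{..<L}"] by blast
      then show ?thesis using that by (auto simp: is_arg_min_linorder)
    qed
    have "K = (\<Union>t<L. K \<inter> slice L t)" using K(1) level_less by (auto simp: slice_def)
    then have "card K = card (\<Union>t<L. K \<inter> slice L t)" by simp
    also have "\<dots> = (\<Sum>t<L. card (K \<inter> slice L t))"
      using \<open>finite K\<close> by (intro card_UN_disjoint) (auto simp: slice_def)
    also have "\<dots> \<ge> (\<Sum>t<L. card (K \<inter> slice L s))"
      using s by (intro sum_mono) auto
    finally have cardK: "L * card (K \<inter> slice L s) \<le> card K" by simp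
    \<comment> \<open>J is where a factor q can be extracted. Every swap site is the upper neighbour
      of a site in J or of v, so J has at least \<open>card K - 1\<close> elements.\<close>
    define J where "J = {u \<in> S - {v}. up L u \<in> K \<or> right L u \<in> K}"
    have "K \<subseteq> up L ` insert v J"
    proof
      fix x assume "x \<in> K"
      then obtain u where "u \<in> S" "x = up L u"
        using K(1) bij_betw_imp_surj_on[OF bij_up[of L]] by (metis imageE subsetD)
      then show "x \<in> up L ` insert v J" using \<open>x \<in> K\<close> by (auto simp: J_def)
    qed
    moreover have "finite J" by (simp add: J_def)
    ultimately have "card K \<le> card (insert v J)" by (meson finite_insert surj_card_le)
    also have "\<dots> = card J + 1" using \<open>finite J\<close> by (simp add: J_def)
    finally have cardJ: "L * card (K \<inter> slice L s) \<le> card J + 1" using cardK by simp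
    have "(\<Prod>u\<in>S - {v}. weight u K) = (\<Prod>u\<in>S - {v}. (if u \<in> J then q else 1) * F u K)"
      by (intro prod.cong refl) (auto simp: weight_def F_def f_def J_def q_def)
    also have "\<dots> = (\<Prod>u\<in>S - {v}. if u \<in> J then q else 1) * (\<Prod>u\<in>S - {v}. F u K)"
      by (rule prod.distrib)
    also have "(\<Prod>u\<in>S - {v}. if u \<in> J then q else 1) = (\<Prod>u\<in>J. q)"
      by (intro prod.mono_neutral_cong_right) (auto simp: J_def)
    also have "(\<Prod>u\<in>S - {v}. F u K) = (\<Prod>u\<in>S. F u K)"
      using v K(2) by (simp add: prod.remove[of S v] F_def f_def)
    \<comment> \<open>One power of q is supplied, at the price 1/q = 3/2, so that the exponent
      reaches \<open>card K\<close>.\<close>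
    also have "(\<Prod>u\<in>J. q) * (\<Prod>u\<in>S. F u K) = 3/2 * (q ^ (card J + 1) * (\<Prod>u\<in>S. F u K))"
      by (simp add: q_def)
    also have "\<dots> \<le> 3/2 * (q ^ (L * card (K \<inter> slice L s)) * (\<Prod>u\<in>S. F u K))"
      by (intro mult_left_mono mult_right_mono power_decreasing cardJ prod_nonneg)
        (auto simp: q_def F0)
    also have "q ^ (L * card (K \<inter> slice L s)) = g (K \<inter> slice L s)"
      using ne[OF s(1)] by (simp add: g_def power_mult)
    also have "g (K \<inter> slice L s) * (\<Prod>u\<in>S. F u K)
        \<le> (\<Sum>t<L. g (K \<inter> slice L t) * (\<Prod>u\<in>S. F u K))"
      using s(1) by (intro member_le_sum[of s "{..<L}" "\<lambda>t. g (K \<inter> slice L t) * (\<Prod>u\<in>S. F u K)"])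
         (auto intro!: mult_nonneg_nonneg prod_nonneg g0 F0)
    finally show ?thesis by simp
  qed
  \<comment> \<open>K is split into its part A on antidiagonal t, kept as boundary condition, and
    its part off it, which is summed out at a factor of at most 1.\<close>
  have slice_le: "(\<Sum>K\<in>Pow S. g (K \<inter> slice L t) * (\<Prod>u\<in>S. F u K)) \<le> (1 + q ^ L) ^ L - 1"
    if t: "t < L" for t
  proof -
    define T where "T = slice L t"
    have T: "T \<subseteq> S" "finite T" by (auto simp: T_def slice_def)
    then have S: "S = T \<union> (S - T)" by auto
    have "(\<Sum>K\<in>Pow S. g (K \<inter> T) * (\<Prod>u\<in>S. F u K)) =
        (\<Sum>A\<in>Pow T. \<Sum>K\<in>Pow (S - T). g ((A \<union> K) \<inter> T) * (\<Prod>u\<in>S. F u (A \<union> K)))"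
      by (subst S, rule sum_Pow_Un_disjoint) (use T in auto)
    also have "\<dots> \<le> (\<Sum>A\<in>Pow T. g A)"
    proof (intro sum_mono)
      fix A assume "A \<in> Pow T"
      then have A: "A \<subseteq> T" by simp
      have "(\<Sum>K\<in>Pow (S - T). g ((A \<union> K) \<inter> T) * (\<Prod>u\<in>S. F u (A \<union> K))) \<le>
        (\<Sum>K\<in>Pow (S - T). g A * (\<Prod>u\<in>S - T. F u (K \<union> A)))"
      proof (intro sum_mono)
        fix K assume K: "K \<in> Pow (S - T)"
        have "(A \<union> K) \<inter> T = A" using A K by auto
        moreover have "(\<Prod>u\<in>S. F u (A \<union> K)) \<le> (\<Prod>u\<in>S - T. F u (K \<union> A))"
        proof -
          have "(\<Prod>u\<in>S. F u (A \<union> K)) = (\<Prod>u\<in>S - T. F u (A \<union> K)) * (\<Prod>u\<in>T. F u (A \<union> K))"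
            using T by (intro prod.subset_diff) auto
          also have "\<dots> \<le> (\<Prod>u\<in>S - T. F u (A \<union> K)) * 1"
            by (intro mult_left_mono prod_le_1 prod_nonneg) (auto simp: F0 F1)
          finally show ?thesis by (simp add: Un_commute)
        qed
        ultimately show "g ((A \<union> K) \<inter> T) * (\<Prod>u\<in>S. F u (A \<union> K)) \<le> g A * (\<Prod>u\<in>S - T. F u (K \<union> A))"
          using g0 by (simp add: mult_left_mono)
      qed
      also have "\<dots> = g A * (\<Sum>K\<in>Pow (S - T). \<Prod>u\<in>S - T. F u (K \<union> A))"
        by (simp add: sum_distrib_left)
      also have "\<dots> \<le> g A * 1"
        unfolding F_def using A
        by (intro mult_left_mono sum_off_slice_le_1[OF _ t] f0 fsum g0) (auto simp: T_def)
      finally show "(\<Sum>K\<in>Pow (S - T). g ((A \<union> K) \<inter> T) * (\<Prod>u\<in>S. F u (A \<union> K))) \<le> g A" by simp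
    qed
    \<comment> \<open>The empty set contributes 1 to the binomial sum and is subtracted, as g
      vanishes there.\<close>
    also have "\<dots> = (\<Sum>A\<in>Pow T. (q ^ L) ^ card A - (if A = {} then 1 else 0))"
      by (intro sum.cong) (auto simp: g_def)
    also have "\<dots> = (1 + q ^ L) ^ card T - 1"
      using T sum_power_card_Pow[of T "q ^ L"] by (simp add: sum_subtractf)
    finally show ?thesis using card_slice[OF t] by (simp add: T_def)
  qed
  have "(\<Sum>K\<in>\<K>. \<Prod>u\<in>S - {v}. weight u K) \<le>
      (\<Sum>K\<in>\<K>. 3/2 * (\<Sum>t<L. g (K \<inter> slice L t) * (\<Prod>u\<in>S. F u K)))"
    by (intro sum_mono term_le)
  also have "\<dots> \<le> (\<Sum>K\<in>Pow S. 3/2 * (\<Sum>t<L. g (K \<inter> slice L t) * (\<Prod>u\<in>S. F u K)))"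
    by (intro sum_mono2 mult_nonneg_nonneg sum_nonneg prod_nonneg ballI g0 F0) (auto simp: \<K>_def)
  also have "\<dots> = 3/2 * (\<Sum>t<L. \<Sum>K\<in>Pow S. g (K \<inter> slice L t) * (\<Prod>u\<in>S. F u K))"
    by (subst sum.swap) (simp add: sum_distrib_left)
  also have "\<dots> \<le> 3/2 * (\<Sum>t<L. (1 + q ^ L) ^ L - 1)"
    by (intro mult_left_mono sum_mono slice_le) auto
  finally show ?thesis by (simp add: \<K>_def q_def)
qed

text \<open>Splits on whether the antidiagonal after v carries a swap. Both neighbours of v lie on
  it, so without one the factor c at v, which stands for the observable, is
  \<open>c False False\<close>.\<close>

lemma sum_weight_le:
  assumes v: "v \<in> S" and c: "\<And>p r. 0 \<le> c p r" "\<And>p r. c p r \<le> c1" "c False False \<le> c0"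
  shows "(\<Sum>K\<in>{K \<in> Pow S. v \<in> K}. c (up L v \<in> K) (right L v \<in> K) * (\<Prod>u\<in>S - {v}. weight u K))
    \<le> c0 * \<kappa>\<^sup>2 + c1 * (3/2 * real L * ((1 + (2/3) ^ L) ^ L - 1))"
proof -
  define P where "P = slice L ((level L v + 1) mod L)"
  have P: "up L v \<in> P" "right L v \<in> P"
    using v by (auto simp: P_def slice_def level_up level_right up_in_sites right_in_sites)
  have c0: "0 \<le> c0" "0 \<le> c1" using c order_trans by blast+
  have W0: "0 \<le> (\<Prod>u\<in>S - {v}. weight u K)" for K by (simp add: prod_nonneg weight_nonneg)
  have "{K \<in> Pow S. v \<in> K} = {K \<in> Pow S. v \<in> K \<and> K \<inter> P = {}} \<union> {K \<in> Pow S. v \<in> K \<and> K \<inter> P \<noteq> {}}"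
    by auto
  then have "(\<Sum>K\<in>{K \<in> Pow S. v \<in> K}. c (up L v \<in> K) (right L v \<in> K) * (\<Prod>u\<in>S - {v}. weight u K)) =
      (\<Sum>K\<in>{K \<in> Pow S. v \<in> K \<and> K \<inter> P = {}}. c (up L v \<in> K) (right L v \<in> K) * (\<Prod>u\<in>S - {v}. weight u K)) +
      (\<Sum>K\<in>{K \<in> Pow S. v \<in> K \<and> K \<inter> P \<noteq> {}}. c (up L v \<in> K) (right L v \<in> K) * (\<Prod>u\<in>S - {v}. weight u K))"
    by (simp only:) (rule sum.union_disjoint, auto)
  also have "\<dots> \<le> (\<Sum>K\<in>{K \<in> Pow S. v \<in> K \<and> K \<inter> P = {}}. c0 * (\<Prod>u\<in>S - {v}. weight u K)) +
      (\<Sum>K\<in>{K \<in> Pow S. v \<in> K \<and> K \<inter> P \<noteq> {}}. c1 * (\<Prod>u\<in>S - {v}. weight u K))"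
  proof (intro add_mono sum_mono mult_right_mono W0)
    fix K assume "K \<in> {K \<in> Pow S. v \<in> K \<and> K \<inter> P = {}}"
    then have "up L v \<notin> K" "right L v \<notin> K" using P by auto
    then show "c (up L v \<in> K) (right L v \<in> K) \<le> c0" using c by simp
  qed (rule c)
  also have "\<dots> \<le> c0 * \<kappa>\<^sup>2 + c1 * (3/2 * real L * ((1 + (2/3) ^ L) ^ L - 1))"
    unfolding sum_distrib_left[symmetric]
    by (intro add_mono mult_left_mono c0 sum_weight_dead[OF v, folded P_def]
       sum_weight_winding[OF v, folded P_def])
  finally show ?thesis .
qed

end

subsection \<open>Second moments of Haar unitaries\<close>

lemma integral_sum2:
  fixes f :: "'i \<Rightarrow> 'j \<Rightarrow> 'a \<Rightarrow> 'b::{banach, second_countable_topology}"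
  assumes "\<And>p q. p \<in> A \<Longrightarrow> q \<in> B \<Longrightarrow> integrable M (f p q)"
  shows "(\<integral>x. (\<Sum>p\<in>A. \<Sum>q\<in>B. f p q x) \<partial>M) = (\<Sum>p\<in>A. \<Sum>q\<in>B. \<integral>x. f p q x \<partial>M)"
proof -
  have "(\<integral>x. (\<Sum>p\<in>A. \<Sum>q\<in>B. f p q x) \<partial>M) = (\<Sum>p\<in>A. \<integral>x. (\<Sum>q\<in>B. f p q x) \<partial>M)"
    by (rule Bochner_Integration.integral_sum) (intro Bochner_Integration.integrable_sum assms)
  also have "\<dots> = (\<Sum>p\<in>A. \<Sum>q\<in>B. \<integral>x. f p q x \<partial>M)"
    by (intro sum.cong refl Bochner_Integration.integral_sum assms)
  finally show ?thesis .
qed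

lemma mat_adjoint_index:
  assumes "A \<in> carrier_mat n m" "i < m" "j < n"
  shows "mat_adjoint A $$ (i, j) = cnj (A $$ (j, i))"
  using assms unfolding mat_adjoint_def by (simp add: mat_of_rows_def)

lemma mat_adjoint_carrier: "A \<in> carrier_mat n m \<Longrightarrow> mat_adjoint A \<in> carrier_mat m n"
  unfolding mat_adjoint_def by auto

lemma mult_mat_index_sum:
  assumes "A \<in> carrier_mat n m" "B \<in> carrier_mat m l" "i < n" "j < l"
  shows "(A * B) $$ (i, j) = (\<Sum>k<m. A $$ (i, k) * B $$ (k, j))"
  using assms by (simp add: scalar_prod_def atLeast0LessThan)

text \<open>Orthonormality of rows and columns in entries, the form in which the explicit unitaries
  below are checked and in which index contractions are evaluated.\<close>

lemma unitary_group_iff: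
  "U \<in> unitary_group n \<longleftrightarrow> U \<in> carrier_mat n n \<and>
    (\<forall>i<n. \<forall>j<n. (\<Sum>k<n. U $$ (i, k) * cnj (U $$ (j, k))) = of_bool (i = j)) \<and>
    (\<forall>i<n. \<forall>j<n. (\<Sum>k<n. cnj (U $$ (k, i)) * U $$ (k, j)) = of_bool (i = j))"
proof (cases "U \<in> carrier_mat n n")
  case True
  note adj = mat_adjoint_carrier[OF True]
  have "U * mat_adjoint U = 1\<^sub>m n \<longleftrightarrow>
      (\<forall>i<n. \<forall>j<n. (\<Sum>k<n. U $$ (i, k) * cnj (U $$ (j, k))) = of_bool (i = j))"
    using True adj
    by (auto simp: mat_eq_iff mult_mat_index_sum[OF True adj] mat_adjoint_index[OF True]
        simp del: index_mult_mat(1))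
  moreover have "mat_adjoint U * U = 1\<^sub>m n \<longleftrightarrow>
      (\<forall>i<n. \<forall>j<n. (\<Sum>k<n. cnj (U $$ (k, i)) * U $$ (k, j)) = of_bool (i = j))"
    using True adj
    by (auto simp: mat_eq_iff mult_mat_index_sum[OF adj True] mat_adjoint_index[OF True]
        simp del: index_mult_mat(1))
  ultimately show ?thesis
    using True by (simp add: unitary_group_def)
qed (simp add: unitary_group_def)

lemma unitary_group_mult:
  assumes "V \<in> unitary_group n" "U \<in> unitary_group n"
  shows "V * U \<in> unitary_group n"
proof -
  have c: "V \<in> carrier_mat n n" "U \<in> carrier_mat n n" using assms by (auto simp: unitary_group_def)
  note ac = mat_adjoint_carrier[OF c(1)] mat_adjoint_carrier[OF c(2)]
  have adj: "mat_adjoint (V * U) = mat_adjoint U * mat_adjoint V"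
  proof (rule eq_matI)
    fix i j assume ij: "i < dim_row (mat_adjoint U * mat_adjoint V)" "j < dim_col (mat_adjoint U * mat_adjoint V)"
    then have ij: "i < n" "j < n" using ac by auto
    have "mat_adjoint (V * U) $$ (i, j) = cnj ((V * U) $$ (j, i))"
      using ij c by (intro mat_adjoint_index) auto
    also have "\<dots> = (mat_adjoint U * mat_adjoint V) $$ (i, j)"
      unfolding mult_mat_index_sum[OF c ij(2,1)] mult_mat_index_sum[OF ac(2,1) ij]
      using ij by (auto simp: mat_adjoint_index[OF c(1)] mat_adjoint_index[OF c(2)] mult.commute intro: sum.cong)
    finally show "mat_adjoint (V * U) $$ (i, j) = (mat_adjoint U * mat_adjoint V) $$ (i, j)" .
  qed (use c ac mat_adjoint_carrier[of "V * U" n n] in auto)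
  have "V * U * (mat_adjoint U * mat_adjoint V) = V * (U * mat_adjoint U) * mat_adjoint V"
    using c ac by (simp add: assoc_mult_mat[of _ n n _ n _ n])
  moreover have "mat_adjoint U * mat_adjoint V * (V * U) = mat_adjoint U * (mat_adjoint V * V) * U"
    using c ac by (simp add: assoc_mult_mat[of _ n n _ n _ n])
  ultimately show ?thesis
    using assms c ac by (simp add: unitary_group_def adj)
qed

text \<open>\<open>pairing False\<close> and \<open>pairing True\<close> are the identity and the swap in \<open>S\<^sub>2\<close>, as tensors on two
  copies of the bra (indices 1, 3) and of the ket (indices 2, 4).\<close>

definition pairing :: "bool \<Rightarrow> nat \<Rightarrow> nat \<Rightarrow> nat \<Rightarrow> nat \<Rightarrow> complex" where
  "pairing s i1 i2 i3 i4 = of_bool (if s then i1 = i4 \<and> i3 = i2 else i1 = i2 \<and> i3 = i4)"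

text \<open>The inverse of the Gram matrix of the two pairings, which has n^2 on the diagonal and n
  off it.\<close>

definition weingarten :: "nat \<Rightarrow> bool \<Rightarrow> bool \<Rightarrow> real" where
  "weingarten n s t = (if s = t then 1 else - 1 / real n) / ((real n)\<^sup>2 - 1)"

locale haar = prob_space \<mu> for \<mu> :: "complex mat measure" +
  fixes n :: nat
  assumes haar: "haar_unitary n \<mu>"
begin

lemma sets_haar: "sets \<mu> = sets (unitary_borel n)"
  using haar by (simp add: haar_unitary_def)

lemma space_haar: "space \<mu> = unitary_group n"
  using sets_eq_imp_space_eq[OF sets_haar] by (simp add: unitary_borel_def)

lemma entry_map_measurable:
  "(\<lambda>U. \<lambda>p\<in>{..<n} \<times> {..<n}. U $$ p) \<in> measurable \<mu> (\<Pi>\<^sub>M p\<in>{..<n} \<times> {..<n}. borel)"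
  unfolding measurable_cong_sets[OF sets_haar refl] unitary_borel_def
  by (intro measurable_vimage_algebra1) (auto simp: space_PiM)

lemma entry_measurable [measurable]:
  assumes "i < n" "j < n" shows "(\<lambda>U. U $$ (i, j)) \<in> borel_measurable \<mu>"
proof -
  have "(\<lambda>U. (\<lambda>p\<in>{..<n} \<times> {..<n}. U $$ p) (i, j)) \<in> borel_measurable \<mu>"
    by (rule measurable_compose[OF entry_map_measurable measurable_component_singleton]) (use assms in auto)
  then show ?thesis using assms by simp
qed

text \<open>The sigma-algebra is generated by the entries, and the entries of V * U are linear
  combinations of those of U.\<close>

lemma mult_left_measurable:
  assumes V: "V \<in> unitary_group n"
  shows "(\<lambda>U. V * U) \<in> measurable \<mu> \<mu>"
proof -
  have Vc: "V \<in> carrier_mat n n" using V by (simp add: unitary_group_def)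
  have "(\<lambda>U. V * U) \<in> measurable \<mu> (unitary_borel n)"
    unfolding unitary_borel_def
  proof (rule measurable_vimage_algebra2)
    show "(\<lambda>U. V * U) \<in> space \<mu> \<rightarrow> unitary_group n"
      using unitary_group_mult[OF V] by (auto simp: space_haar)
    show "(\<lambda>U. \<lambda>p\<in>{..<n} \<times> {..<n}. (V * U) $$ p) \<in> measurable \<mu> (\<Pi>\<^sub>M p\<in>{..<n} \<times> {..<n}. borel)"
    proof (rule measurable_restrict)
      fix p assume p: "p \<in> {..<n} \<times> {..<n}"
      then obtain i j where ij: "p = (i, j)" "i < n" "j < n" by auto
      have "(\<lambda>U. \<Sum>k<n. V $$ (i, k) * U $$ (k, j)) \<in> borel_measurable \<mu>"
        using ij by (intro borel_measurable_sum borel_measurable_times entry_measurable) auto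
      then show "(\<lambda>U. (V * U) $$ p) \<in> borel_measurable \<mu>"
        by (rule measurable_cong[THEN iffD1, rotated])
          (use ij mult_mat_index_sum[OF Vc] in \<open>auto simp: space_haar unitary_group_def\<close>)
    qed
  qed
  then show ?thesis by (simp add: measurable_cong_sets[OF refl sets_haar])
qed

lemma integral_mult_left:
  fixes f :: "complex mat \<Rightarrow> complex"
  assumes "V \<in> unitary_group n" "f \<in> borel_measurable \<mu>"
  shows "(\<integral>U. f (V * U) \<partial>\<mu>) = (\<integral>U. f U \<partial>\<mu>)"
proof -
  have "(\<integral>U. f U \<partial>\<mu>) = (\<integral>U. f U \<partial>(distr \<mu> \<mu> (\<lambda>U. V * U)))"
    using haar assms(1) by (simp add: haar_unitary_def)
  also have "\<dots> = (\<integral>U. f (V * U) \<partial>\<mu>)"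
    by (rule integral_distr[OF mult_left_measurable[OF assms(1)] assms(2)])
  finally show ?thesis ..
qed

lemma norm_entry_le_1:
  assumes "U \<in> unitary_group n" "i < n" "j < n"
  shows "cmod (U $$ (i, j)) \<le> 1"
proof -
  have "complex_of_real (\<Sum>k<n. (cmod (U $$ (i, k)))\<^sup>2) = (\<Sum>k<n. U $$ (i, k) * cnj (U $$ (i, k)))"
    by (simp only: of_real_sum complex_norm_square)
  also have "\<dots> = 1" using assms by (simp add: unitary_group_iff)
  finally have "(\<Sum>k<n. (cmod (U $$ (i, k)))\<^sup>2) = 1" by (metis of_real_eq_1_iff)
  then have "(cmod (U $$ (i, j)))\<^sup>2 \<le> 1"
    using member_le_sum[of j "{..<n}" "\<lambda>k. (cmod (U $$ (i, k)))\<^sup>2"] assms by simp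
  then show ?thesis by (simp add: power_le_one_iff abs_le_square_iff[symmetric] power2_le_iff_abs_le)
qed

section \<open>Fourth-order moments of the matrix entries\<close>

definition moment where
  "moment i1 j1 i2 j2 i3 j3 i4 j4 =
    (\<integral>U. cnj (U $$ (i1, j1)) * U $$ (i2, j2) * cnj (U $$ (i3, j3)) * U $$ (i4, j4) \<partial>\<mu>)"

lemma monomial_measurable [measurable]:
  assumes "i1 < n" "i2 < n" "i3 < n" "i4 < n" "j1 < n" "j2 < n" "j3 < n" "j4 < n"
  shows "(\<lambda>U. cnj (U $$ (i1, j1)) * U $$ (i2, j2) * cnj (U $$ (i3, j3)) * U $$ (i4, j4)) \<in> borel_measurable \<mu>"
  using assms
  by (intro borel_measurable_times entry_measurable
      measurable_compose[OF entry_measurable borel_measurable_continuous_onI[OF continuous_on_cnj[OF continuous_on_id]]])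

lemma monomial_integrable:
  assumes "i1 < n" "i2 < n" "i3 < n" "i4 < n" "j1 < n" "j2 < n" "j3 < n" "j4 < n"
  shows "integrable \<mu> (\<lambda>U. cnj (U $$ (i1, j1)) * U $$ (i2, j2) * cnj (U $$ (i3, j3)) * U $$ (i4, j4))"
proof (rule integrable_const_bound[where B = 1])
  show "AE U in \<mu>. cmod (cnj (U $$ (i1, j1)) * U $$ (i2, j2) * cnj (U $$ (i3, j3)) * U $$ (i4, j4)) \<le> 1"
    using norm_entry_le_1 assms
    by (intro AE_I2) (auto simp: space_haar norm_mult intro!: mult_le_one)
qed (rule monomial_measurable[OF assms])

lemma moment_mult_left:
  assumes V: "V \<in> unitary_group n"
    and i: "i1 < n" "i2 < n" "i3 < n" "i4 < n" and j: "j1 < n" "j2 < n" "j3 < n" "j4 < n"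
  shows "moment i1 j1 i2 j2 i3 j3 i4 j4 =
    (\<integral>U. cnj (\<Sum>k<n. V $$ (i1, k) * U $$ (k, j1)) * (\<Sum>k<n. V $$ (i2, k) * U $$ (k, j2)) *
      cnj (\<Sum>k<n. V $$ (i3, k) * U $$ (k, j3)) * (\<Sum>k<n. V $$ (i4, k) * U $$ (k, j4)) \<partial>\<mu>)"
proof -
  have Vc: "V \<in> carrier_mat n n" using V by (simp add: unitary_group_def)
  show ?thesis
    unfolding moment_def integral_mult_left[OF V monomial_measurable[OF i j], symmetric]
    by (rule Bochner_Integration.integral_cong)
      (auto simp: mult_mat_index_sum[OF Vc] space_haar unitary_group_def i j)
qed

text \<open>Invariance under the diagonal unitary that multiplies row p by \<i>. A sign -1 would not
  do: it cancels when p occurs in both bra indices and in no ket index, whereas \<i> then gives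
  -1.\<close>

lemma moment_phase:
  assumes p: "p < n"
    and i: "i1 < n" "i2 < n" "i3 < n" "i4 < n" and j: "j1 < n" "j2 < n" "j3 < n" "j4 < n"
  defines "\<phi> \<equiv> \<lambda>i. if i = p then \<i> else 1"
  shows "moment i1 j1 i2 j2 i3 j3 i4 j4 =
    cnj (\<phi> i1) * \<phi> i2 * cnj (\<phi> i3) * \<phi> i4 * moment i1 j1 i2 j2 i3 j3 i4 j4"
proof -
  define V where "V = mat n n (\<lambda>(i, k). if k = i then \<phi> i else 0)"
  have V: "V \<in> unitary_group n"
    by (auto simp: unitary_group_iff V_def \<phi>_def if_distrib[of cnj] if_distrib[of "\<lambda>x. _ * x"]
      if_distrib[of "\<lambda>x. x * _"] cong: if_cong)
  have row: "(\<Sum>k<n. V $$ (i, k) * U $$ (k, j)) = \<phi> i * U $$ (i, j)" if "i < n" for i j U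
    using that by (simp add: V_def if_distrib[of "\<lambda>x. x * _"] cong: if_cong)
  have "moment i1 j1 i2 j2 i3 j3 i4 j4 = (\<integral>U. (cnj (\<phi> i1) * \<phi> i2 * cnj (\<phi> i3) * \<phi> i4) *
      (cnj (U $$ (i1, j1)) * U $$ (i2, j2) * cnj (U $$ (i3, j3)) * U $$ (i4, j4)) \<partial>\<mu>)"
    unfolding moment_mult_left[OF V i j] row[OF i(1)] row[OF i(2)] row[OF i(3)] row[OF i(4)]
    by (intro Bochner_Integration.integral_cong refl) (simp add: mult_ac)
  also have "\<dots> = cnj (\<phi> i1) * \<phi> i2 * cnj (\<phi> i3) * \<phi> i4 * moment i1 j1 i2 j2 i3 j3 i4 j4"
    unfolding moment_def by (rule integral_mult_right_zero)
  finally show ?thesis .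
qed

text \<open>If the bra rows are not a rearrangement of the ket rows, then i1 or i3 is missing from
  the kets, or i1 = i3 occurs exactly once there. In each case the phase at i1 or i3 differs from 1,
  so the moment equals a nontrivial multiple of itself.\<close>

lemma moment_eq_0:
  assumes i: "i1 < n" "i2 < n" "i3 < n" "i4 < n" and j: "j1 < n" "j2 < n" "j3 < n" "j4 < n"
    and "\<not> (i1 = i2 \<and> i3 = i4)" "\<not> (i1 = i4 \<and> i3 = i2)"
  shows "moment i1 j1 i2 j2 i3 j3 i4 j4 = 0"
proof -
  have *: "x = 0" if "x = c * x" "c \<noteq> 1" for x c :: complex using that by simp
  have "i1 \<noteq> i2 \<and> i1 \<noteq> i4 \<or> i3 \<noteq> i2 \<and> i3 \<noteq> i4 \<or> i1 = i3 \<and> (i2 = i1) \<noteq> (i4 = i1)"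
    using assms by auto
  then have "(let \<phi> = \<lambda>i. if i = i1 then \<i> else 1 in cnj (\<phi> i1) * \<phi> i2 * cnj (\<phi> i3) * \<phi> i4) \<noteq> 1 \<or>
      (let \<phi> = \<lambda>i. if i = i3 then \<i> else 1 in cnj (\<phi> i1) * \<phi> i2 * cnj (\<phi> i3) * \<phi> i4) \<noteq> 1"
    by (auto simp: complex_eq_iff)
  then show ?thesis
    using *[OF moment_phase[OF i(1) i j]] *[OF moment_phase[OF i(3) i j]] by (auto simp only: Let_def)
qed

text \<open>Invariance under a permutation matrix, whose product with U has row \<pi> i of U as row
  i. Hence only the coincidence pattern of the row indices matters.\<close>

lemma moment_permute:
  assumes \<pi>: "bij_betw \<pi> {..<n} {..<n}"
    and i: "i1 < n" "i2 < n" "i3 < n" "i4 < n" and j: "j1 < n" "j2 < n" "j3 < n" "j4 < n"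
  shows "moment i1 j1 i2 j2 i3 j3 i4 j4 = moment (\<pi> i1) j1 (\<pi> i2) j2 (\<pi> i3) j3 (\<pi> i4) j4"
proof -
  define V where "V = mat n n (\<lambda>(i, k). if k = \<pi> i then 1 else 0 :: complex)"
  have \<pi>n: "\<pi> i < n" if "i < n" for i using \<pi> that by (auto simp: bij_betw_def)
  have inj: "\<pi> i = \<pi> k \<longleftrightarrow> i = k" if "i < n" "k < n" for i k
    using \<pi> that by (auto simp: bij_betw_def inj_on_def)
  have "(\<Sum>k<n. (if i = \<pi> k then 1 else 0) * (if j = \<pi> k then 1 else 0)) = (of_bool (i = j) :: complex)"
    if ij: "i < n" "j < n" for i j
  proof -
    have "(\<Sum>k<n. (if i = \<pi> k then 1 else 0) * (if j = \<pi> k then 1 else 0)) =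
        (\<Sum>k<n. (if i = k then 1 else 0) * (if j = k then 1 else 0 :: complex))"
      by (rule sum.reindex_bij_betw[OF \<pi>, of "\<lambda>k. (if i = k then 1 else 0) * (if j = k then 1 else 0)"])
    also have "\<dots> = of_bool (i = j)"
      using ij by (auto simp: if_distrib[of "\<lambda>x. x * _"] cong: if_cong)
    finally show ?thesis .
  qed
  then have V: "V \<in> unitary_group n"
    using \<pi>n inj by (auto simp: unitary_group_iff V_def if_distrib[of cnj] if_distrib[of "\<lambda>x. x * _"] cong: if_cong)
  have row: "(\<Sum>k<n. V $$ (i, k) * U $$ (k, j)) = U $$ (\<pi> i, j)" if "i < n" for i j U
    using that \<pi>n by (simp add: V_def if_distrib[of "\<lambda>x. x * _"] cong: if_cong)
  show ?thesis
    unfolding moment_mult_left[OF V i j] row[OF i(1)] row[OF i(2)] row[OF i(3)] row[OF i(4)]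
    unfolding moment_def ..
qed

text \<open>Invariance under a Hadamard rotation of the first two rows.\<close>

lemma moment_rotate:
  assumes n: "n \<ge> 2" and j: "j1 < n" "j2 < n" "j3 < n" "j4 < n"
  defines "M \<equiv> \<lambda>i1 i2 i3 i4. moment i1 j1 i2 j2 i3 j3 i4 j4"
  shows "M 0 0 0 0 = M 0 0 1 1 + M 0 1 1 0"
proof -
  define s where "s = complex_of_real (1 / sqrt 2)"
  have s2: "s * s = 1/2" by (simp add: s_def flip: of_real_mult)
  have cs: "cnj s = s" by (simp add: s_def)
  define V where "V = mat n n (\<lambda>(i, k). if i < 2 \<and> k < 2 then (if i = 1 \<and> k = 1 then - s else s) else of_bool (i = k))"
  have split: "(\<Sum>k<n. g k) = g 0 + g 1 + (\<Sum>k\<in>{2..<n}. g k)" for g :: "nat \<Rightarrow> complex"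
  proof -
    have "{..<n} = {0, 1} \<union> {2..<n}" using n by auto
    then have "(\<Sum>k<n. g k) = (\<Sum>k\<in>{0, 1}. g k) + (\<Sum>k\<in>{2..<n}. g k)"
      by (simp only:) (rule sum.union_disjoint, auto)
    then show ?thesis by simp
  qed
  have V: "V \<in> unitary_group n"
    unfolding unitary_group_iff
  proof (intro conjI allI impI)
    show "V \<in> carrier_mat n n" by (simp add: V_def)
    fix i j assume ij: "i < n" "j < n"
    have tail: "(\<Sum>k\<in>{2..<n}. of_bool (i = k) * of_bool (j = k)) = (of_bool (i = j \<and> 2 \<le> i) :: complex)"
    proof -
      have "(\<Sum>k\<in>{2..<n}. of_bool (i = k) * of_bool (j = k)) =
          (\<Sum>k\<in>{2..<n}. if k = i then of_bool (i = j) else (0::complex))"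
        by (intro sum.cong) auto
      then show ?thesis using ij by simp
    qed
    have 1: "(\<Sum>k\<in>{2..<n}. V $$ (i, k) * cnj (V $$ (j, k))) = of_bool (i = j \<and> 2 \<le> i)"
      using ij by (subst tail[symmetric], intro sum.cong) (auto simp: V_def)
    have 2: "(\<Sum>k\<in>{2..<n}. cnj (V $$ (k, i)) * V $$ (k, j)) = of_bool (i = j \<and> 2 \<le> i)"
      using ij by (subst tail[symmetric], intro sum.cong) (auto simp: V_def)
    have c: "i = 0 \<or> i = 1 \<or> 2 \<le> i" "j = 0 \<or> j = 1 \<or> 2 \<le> j" by auto
    show "(\<Sum>k<n. V $$ (i, k) * cnj (V $$ (j, k))) = of_bool (i = j)"
      unfolding split 1 using c ij n by (elim disjE) (auto simp: V_def s2 cs)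
    show "(\<Sum>k<n. cnj (V $$ (k, i)) * V $$ (k, j)) = of_bool (i = j)"
      unfolding split 2 using c ij n by (elim disjE) (auto simp: V_def s2 cs)
  qed
  have row: "(\<Sum>k<n. V $$ (0, k) * U $$ (k, j)) = (\<Sum>k\<in>{0, 1}. s * U $$ (k, j))" for j U
    unfolding split using n by (simp add: V_def)
  have z: "0 < n" using n by simp
  have lt: "k < n" if "k \<in> {0, 1}" for k using that n by auto
  have "M 0 0 0 0 = (\<integral>U. (\<Sum>a\<in>{0,1}. \<Sum>b\<in>{0,1}. \<Sum>c\<in>{0,1}. \<Sum>d\<in>{0,1}. 1/4 *
      (cnj (U $$ (a, j1)) * U $$ (b, j2) * cnj (U $$ (c, j3)) * U $$ (d, j4))) \<partial>\<mu>)"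
    unfolding M_def moment_mult_left[OF V z z z z j] row
  proof (intro Bochner_Integration.integral_cong refl)
    fix U :: "complex mat"
    have "s * (s * (s * s)) = (s * s) * (s * s)" by simp
    then have s4: "s * (s * (s * s)) = 1/4" unfolding s2 by simp
    have "cnj (\<Sum>k\<in>{0, 1}. s * U $$ (k, j1)) * (\<Sum>k\<in>{0, 1}. s * U $$ (k, j2)) *
         cnj (\<Sum>k\<in>{0, 1}. s * U $$ (k, j3)) * (\<Sum>k\<in>{0, 1}. s * U $$ (k, j4)) =
       s * (s * (s * s)) * (cnj (\<Sum>k\<in>{0, 1}. U $$ (k, j1)) * (\<Sum>k\<in>{0, 1}. U $$ (k, j2)) *
         cnj (\<Sum>k\<in>{0, 1}. U $$ (k, j3)) * (\<Sum>k\<in>{0, 1}. U $$ (k, j4)))"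
      by (simp add: sum_distrib_left[symmetric] cs del: sum.insert)
    also have "\<dots> = (\<Sum>a\<in>{0,1}. \<Sum>b\<in>{0,1}. \<Sum>c\<in>{0,1}. \<Sum>d\<in>{0,1}. 1/4 *
      (cnj (U $$ (a, j1)) * U $$ (b, j2) * cnj (U $$ (c, j3)) * U $$ (d, j4)))"
      unfolding s4 by (simp add: algebra_simps)
    finally show "cnj (\<Sum>k\<in>{0, 1}. s * U $$ (k, j1)) * (\<Sum>k\<in>{0, 1}. s * U $$ (k, j2)) *
         cnj (\<Sum>k\<in>{0, 1}. s * U $$ (k, j3)) * (\<Sum>k\<in>{0, 1}. s * U $$ (k, j4)) = \<dots>" .
  qed
  also have "\<dots> = (\<Sum>a\<in>{0,1}. \<Sum>b\<in>{0,1}. \<Sum>c\<in>{0,1}. \<Sum>d\<in>{0,1}. 1/4 * M a b c d)"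
    unfolding M_def moment_def
    by (subst Bochner_Integration.integral_sum, intro Bochner_Integration.integrable_sum integrable_mult_right monomial_integrable j lt, assumption+,
        intro sum.cong refl)+
      (rule integral_mult_right_zero)
  \<comment> \<open>Of the 16 terms the ten with unpaired rows vanish; exchanging rows 0 and 1
    identifies the remaining six in pairs.\<close>
  also have "\<dots> = 1/4 * (M 0 0 0 0 + M 0 0 1 1 + M 0 1 1 0 + M 1 0 0 1 + M 1 1 0 0 + M 1 1 1 1)"
    using n j by (simp add: M_def moment_eq_0)
  also have "\<dots> = 1/4 * (2 * M 0 0 0 0 + 2 * M 0 0 1 1 + 2 * M 0 1 1 0)"
  proof -
    have p: "bij_betw (Transposition.transpose 0 1) {..<n} {..<n}"
      using n by (intro permutes_imp_bij permutes_swap_id) auto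
    have *: "M a b c d = M (Transposition.transpose 0 1 a) (Transposition.transpose 0 1 b)
        (Transposition.transpose 0 1 c) (Transposition.transpose 0 1 d)"
      if "a < n" "b < n" "c < n" "d < n" for a b c d
      unfolding M_def by (rule moment_permute[OF p that j])
    have "M 1 0 0 1 = M 0 1 1 0" "M 1 1 0 0 = M 0 0 1 1" "M 1 1 1 1 = M 0 0 0 0"
      using *[of 1 0 0 1] *[of 1 1 0 0] *[of 1 1 1 1] n by auto
    then show ?thesis by simp
  qed
  finally have "M 0 0 0 0 = 1/4 * (2 * M 0 0 0 0 + 2 * M 0 0 1 1 + 2 * M 0 1 1 0)" .
  moreover have "x = y + z" if "x = 1/4 * (2 * x + 2 * y + 2 * z)" for x y z :: complex
    using that by (simp add: complex_eq_iff)
  ultimately show ?thesis by blast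
qed

text \<open>By permutation invariance rows 0 and 1 represent any two distinct rows. When all four
  rows coincide both pairings equal 1, and the value is the sum of the two coefficients by
  \<open>moment_rotate\<close>.\<close>

lemma moment_pairing:
  assumes n: "n \<ge> 2" and i: "i1 < n" "i2 < n" "i3 < n" "i4 < n" and j: "j1 < n" "j2 < n" "j3 < n" "j4 < n"
  shows "moment i1 j1 i2 j2 i3 j3 i4 j4 =
    moment 0 j1 0 j2 1 j3 1 j4 * pairing False i1 i2 i3 i4 + moment 0 j1 1 j2 1 j3 0 j4 * pairing True i1 i2 i3 i4"
proof -
  define M where "M i1 i2 i3 i4 = moment i1 j1 i2 j2 i3 j3 i4 j4" for i1 i2 i3 i4
  have diag: "M p p p p = M 0 0 1 1 + M 0 1 1 0" if "p < n" for p
  proof -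
    have "bij_betw (Transposition.transpose 0 p) {..<n} {..<n}"
      using n that by (intro permutes_imp_bij permutes_swap_id) auto
    from moment_permute[OF this _ _ _ _ j, of 0 0 0 0] have "M 0 0 0 0 = M p p p p"
      using n by (simp add: M_def)
    then show ?thesis using moment_rotate[OF n j] by (simp add: M_def)
  qed
  have off: "M p p q q = M 0 0 1 1 \<and> M p q q p = M 0 1 1 0" if "p < n" "q < n" "p \<noteq> q" for p q
  proof -
    \<comment> \<open>r is the preimage of q under the transposition of 0 and p, so \<pi> sends 0 to
      p and 1 to q.\<close>
    define r where "r = Transposition.transpose 0 p q"
    define \<pi> where "\<pi> = Transposition.transpose 0 p \<circ> Transposition.transpose 1 r"
    have r: "r < n" "r \<noteq> 0" using n that by (auto simp: r_def Transposition.transpose_def)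
    have "\<pi> permutes {..<n}"
      unfolding \<pi>_def using n that r by (intro permutes_compose permutes_swap_id) auto
    then have bij: "bij_betw \<pi> {..<n} {..<n}" by (rule permutes_imp_bij)
    have \<pi>: "\<pi> 0 = p" "\<pi> 1 = q" using r by (auto simp: \<pi>_def r_def)
    show ?thesis
      using moment_permute[OF bij _ _ _ _ j, of 0 0 1 1] moment_permute[OF bij _ _ _ _ j, of 0 1 1 0] n
      unfolding \<pi> by (simp add: M_def)
  qed
  consider "i1 = i2" "i3 = i4" "i1 = i3" | "i1 = i2" "i3 = i4" "i1 \<noteq> i3" | "i1 = i4" "i3 = i2" "i1 \<noteq> i3"
    | "\<not> (i1 = i2 \<and> i3 = i4)" "\<not> (i1 = i4 \<and> i3 = i2)" by blast
  then have "M i1 i2 i3 i4 = M 0 0 1 1 * pairing False i1 i2 i3 i4 + M 0 1 1 0 * pairing True i1 i2 i3 i4"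
  proof cases
    case 1 then show ?thesis using diag[OF i(1)] by (simp add: pairing_def)
  next
    case 2 then show ?thesis using off[OF i(1,3)] by (simp add: pairing_def)
  next
    case 3 then show ?thesis using off[OF i(1,3)] by (simp add: pairing_def)
  next
    case 4
    have "pairing False i1 i2 i3 i4 = 0" "pairing True i1 i2 i3 i4 = 0"
      unfolding pairing_def if_True if_False using 4 by (simp_all only: of_bool_eq)
    moreover have "M i1 i2 i3 i4 = 0" unfolding M_def by (rule moment_eq_0[OF i j 4])
    ultimately show ?thesis by simp
  qed
  then show ?thesis by (simp add: M_def)
qed

text \<open>The two coefficients of \<open>moment_pairing\<close> are determined by contracting the
  row indices along either pairing: unitarity evaluates the integrand, and the two resulting linear
  equations have the Gram matrix as coefficients.\<close>

lemma moment_weingarten: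
  assumes n: "n \<ge> 2" and i: "i1 < n" "i2 < n" "i3 < n" "i4 < n" and j: "j1 < n" "j2 < n" "j3 < n" "j4 < n"
  shows "moment i1 j1 i2 j2 i3 j3 i4 j4 = (\<Sum>s\<in>UNIV. \<Sum>t\<in>UNIV.
    of_real (weingarten n s t) * pairing s i1 i2 i3 i4 * pairing t j1 j2 j3 j4)"
proof -
  define a b where "a = moment 0 j1 0 j2 1 j3 1 j4" and "b = moment 0 j1 1 j2 1 j3 0 j4"
  have "(\<Sum>p<n. \<Sum>q<n. moment p j1 p j2 q j3 q j4) = (\<integral>U. (\<Sum>p<n. \<Sum>q<n.
      cnj (U $$ (p, j1)) * U $$ (p, j2) * cnj (U $$ (q, j3)) * U $$ (q, j4)) \<partial>\<mu>)"
    unfolding moment_def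
    by (rule integral_sum2[symmetric]) (auto intro!: monomial_integrable j)
  also have "\<dots> = (\<integral>U. pairing False j1 j2 j3 j4 \<partial>\<mu>)"
  proof (intro Bochner_Integration.integral_cong refl)
    fix U assume "U \<in> space \<mu>"
    then have U: "U \<in> unitary_group n" by (simp add: space_haar)
    have "(\<Sum>p<n. \<Sum>q<n. cnj (U $$ (p, j1)) * U $$ (p, j2) * cnj (U $$ (q, j3)) * U $$ (q, j4)) =
       (\<Sum>p<n. cnj (U $$ (p, j1)) * U $$ (p, j2)) * (\<Sum>q<n. cnj (U $$ (q, j3)) * U $$ (q, j4))"
      by (simp add: sum_product mult.assoc)
    also have "\<dots> = pairing False j1 j2 j3 j4"
      using U j by (simp add: unitary_group_iff pairing_def)
    finally show "(\<Sum>p<n. \<Sum>q<n. cnj (U $$ (p, j1)) * U $$ (p, j2) * cnj (U $$ (q, j3)) * U $$ (q, j4)) =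
       pairing False j1 j2 j3 j4" .
  qed
  also have "\<dots> = pairing False j1 j2 j3 j4" by (simp add: prob_space)
  also have "(\<Sum>p<n. \<Sum>q<n. moment p j1 p j2 q j3 q j4) = (\<Sum>p<n. \<Sum>q<n. a + b * of_bool (p = q))"
    unfolding a_def b_def
    by (intro sum.cong refl) (subst moment_pairing[OF n _ _ _ _ j], auto simp: pairing_def)
  also have "\<dots> = a * of_nat n ^ 2 + b * of_nat n"
    by (simp add: sum.distrib sum_distrib_left[symmetric] power2_eq_square algebra_simps)
  finally have I: "a * of_nat n ^ 2 + b * of_nat n = pairing False j1 j2 j3 j4" .
  have "(\<Sum>p<n. \<Sum>q<n. moment p j1 q j2 q j3 p j4) = (\<integral>U. (\<Sum>p<n. \<Sum>q<n.
      cnj (U $$ (p, j1)) * U $$ (q, j2) * cnj (U $$ (q, j3)) * U $$ (p, j4)) \<partial>\<mu>)"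
    unfolding moment_def
    by (rule integral_sum2[symmetric]) (auto intro!: monomial_integrable j)
  also have "\<dots> = (\<integral>U. pairing True j1 j2 j3 j4 \<partial>\<mu>)"
  proof (intro Bochner_Integration.integral_cong refl)
    fix U assume "U \<in> space \<mu>"
    then have U: "U \<in> unitary_group n" by (simp add: space_haar)
    have "(\<Sum>p<n. \<Sum>q<n. cnj (U $$ (p, j1)) * U $$ (q, j2) * cnj (U $$ (q, j3)) * U $$ (p, j4)) =
       (\<Sum>p<n. cnj (U $$ (p, j1)) * U $$ (p, j4)) * (\<Sum>q<n. cnj (U $$ (q, j3)) * U $$ (q, j2))"
      unfolding sum_product by (intro sum.cong refl) (simp only: mult_ac)
    also have "\<dots> = pairing True j1 j2 j3 j4"
      using U j by (simp add: unitary_group_iff pairing_def)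
    finally show "(\<Sum>p<n. \<Sum>q<n. cnj (U $$ (p, j1)) * U $$ (q, j2) * cnj (U $$ (q, j3)) * U $$ (p, j4)) =
       pairing True j1 j2 j3 j4" .
  qed
  also have "\<dots> = pairing True j1 j2 j3 j4" by (simp add: prob_space)
  also have "(\<Sum>p<n. \<Sum>q<n. moment p j1 q j2 q j3 p j4) = (\<Sum>p<n. \<Sum>q<n. a * of_bool (p = q) + b)"
    unfolding a_def b_def
    by (intro sum.cong refl) (subst moment_pairing[OF n _ _ _ _ j], auto simp: pairing_def)
  also have "\<dots> = a * of_nat n + b * of_nat n ^ 2"
    by (simp add: sum.distrib sum_distrib_left[symmetric] power2_eq_square algebra_simps)
  finally have S: "a * of_nat n + b * of_nat n ^ 2 = pairing True j1 j2 j3 j4" .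
  define N where "N = (of_nat n :: complex)"
  have "1 < (real n)\<^sup>2" using n by (simp add: one_less_power)
  then have "complex_of_real ((real n)\<^sup>2 - 1) \<noteq> 0" by (simp only: of_real_eq_0_iff)
  then have N: "N\<^sup>2 - 1 \<noteq> 0" "N \<noteq> 0" using n by (auto simp: N_def)
  note IS = I[folded N_def] S[folded N_def]
  define c e x y where "c = 1 / (N\<^sup>2 - 1)" and "e = 1 / N"
    and "x = pairing False j1 j2 j3 j4" and "y = pairing True j1 j2 j3 j4"
  have wN: "of_real (weingarten n s t) = (if s = t then c else - e * c)" for s t
    by (simp add: weingarten_def N_def c_def e_def)
  have "a * (N\<^sup>2 - 1) = x - y * e" "b * (N\<^sup>2 - 1) = y - x * e"
    unfolding x_def y_def IS[symmetric] using N
    by (simp_all add: e_def divide_simps) (simp_all add: algebra_simps power2_eq_square)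
  then have ab: "a = (x - y * e) * c" "b = (y - x * e) * c"
    using N by (simp_all add: c_def eq_divide_eq)
  show ?thesis
    unfolding moment_pairing[OF n i j] a_def[symmetric] b_def[symmetric]
    unfolding ab by (simp add: UNIV_bool wN x_def[symmetric] y_def[symmetric] algebra_simps)
qed

end

subsection \<open>Averaging the site tensors\<close>

text \<open>Sum over four copies in the order bra, ket, bra, ket, as in
  \<open>pairing\<close>.\<close>

definition qsum :: "'a set \<Rightarrow> ('a \<Rightarrow> 'a \<Rightarrow> 'a \<Rightarrow> 'a \<Rightarrow> complex) \<Rightarrow> complex" where
  "qsum A f = (\<Sum>(a, b, c, d)\<in>A \<times> A \<times> A \<times> A. f a b c d)"

lemma qsum_nested: "qsum A f = (\<Sum>a\<in>A. \<Sum>b\<in>A. \<Sum>c\<in>A. \<Sum>d\<in>A. f a b c d)"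
  by (simp add: qsum_def sum.cartesian_product)

lemma qsum_cong:
  "(\<And>a b c d. a \<in> A \<Longrightarrow> b \<in> A \<Longrightarrow> c \<in> A \<Longrightarrow> d \<in> A \<Longrightarrow> f a b c d = g a b c d) \<Longrightarrow> qsum A f = qsum A g"
  unfolding qsum_def by (intro sum.cong) auto

lemma qsum_sum: "qsum A (\<lambda>a b c d. \<Sum>k\<in>B. f k a b c d) = (\<Sum>k\<in>B. qsum A (f k))"
  unfolding qsum_def by (subst sum.swap) (simp add: case_prod_beta)

lemma qsum_mult_left: "r * qsum A f = qsum A (\<lambda>a b c d. r * f a b c d)"
  unfolding qsum_def by (simp add: sum_distrib_left case_prod_beta)

lemma prod4_sum:
  "(\<Sum>a\<in>A. f1 a) * (\<Sum>a\<in>A. f2 a) * (\<Sum>a\<in>A. f3 a) * (\<Sum>a\<in>A. f4 a) =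
    qsum A (\<lambda>a b c d. f1 a * f2 b * f3 c * f4 d)"
  unfolding qsum_nested
  by (simp only: sum_distrib_left[symmetric] sum_distrib_right[symmetric])

text \<open>Factorization over sites: summing four global configurations is summing four local
  indices at each site. The bound variable \<open>bond_dim_power\<close> is, here and below, the
  fourth copy after \<open>x1\<close>, \<open>x2\<close>, \<open>x3\<close>.\<close>

lemma prod_qsum_PiE:
  assumes "finite S" "finite A"
  shows "(\<Prod>u\<in>S. qsum A (f u)) =
    qsum (S \<rightarrow>\<^sub>E A) (\<lambda>x1 x2 x3 bond_dim_power. \<Prod>u\<in>S. f u (x1 u) (x2 u) (x3 u) (bond_dim_power u))"
  unfolding qsum_nested using assms by (simp add: prod_sum_PiE)

lemma integral_qsum:
  assumes "\<And>a b c d. a \<in> A \<Longrightarrow> b \<in> A \<Longrightarrow> c \<in> A \<Longrightarrow> d \<in> A \<Longrightarrow> integrable M (f a b c d)"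
  shows "(\<integral>x. qsum A (\<lambda>a b c d. f a b c d x) \<partial>M) = qsum A (\<lambda>a b c d. \<integral>x. f a b c d x \<partial>M)"
  unfolding qsum_def case_prod_beta
  by (rule Bochner_Integration.integral_sum) (use assms in auto)

lemma integrable_qsum:
  assumes "\<And>a b c d. a \<in> A \<Longrightarrow> b \<in> A \<Longrightarrow> c \<in> A \<Longrightarrow> d \<in> A \<Longrightarrow> integrable M (f a b c d)"
  shows "integrable M (\<lambda>x. qsum A (\<lambda>a b c d. f a b c d x))"
  unfolding qsum_def case_prod_beta
  by (rule Bochner_Integration.integrable_sum) (use assms in auto)

text \<open>Regroups four triples into three quadruples, so that the two bond legs and the physical
  leg of a site are contracted independently.\<close>

lemma qsum_triple:
  "qsum (A \<times> B \<times> C) (\<lambda>z1 z2 z3 z4.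
      f (fst z1) (fst z2) (fst z3) (fst z4) *
      g (fst (snd z1)) (fst (snd z2)) (fst (snd z3)) (fst (snd z4)) *
      h (snd (snd z1)) (snd (snd z2)) (snd (snd z3)) (snd (snd z4))) = qsum A f * qsum B g * qsum C h"
proof -
  have "qsum A f * qsum B g * qsum C h =
    (\<Sum>(((a1, a2, a3, a4), (b1, b2, b3, b4)), (c1, c2, c3, c4))\<in>((A \<times> A \<times> A \<times> A) \<times> (B \<times> B \<times> B \<times> B)) \<times> (C \<times> C \<times> C \<times> C).
      f a1 a2 a3 a4 * g b1 b2 b3 b4 * h c1 c2 c3 c4)"
    unfolding qsum_def sum_product sum.cartesian_product by (simp add: case_prod_beta)
  also have "\<dots> = qsum (A \<times> B \<times> C) (\<lambda>z1 z2 z3 z4.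
      f (fst z1) (fst z2) (fst z3) (fst z4) *
      g (fst (snd z1)) (fst (snd z2)) (fst (snd z3)) (fst (snd z4)) *
      h (snd (snd z1)) (snd (snd z2)) (snd (snd z3)) (snd (snd z4)))"
    unfolding qsum_def
    by (rule sum.reindex_bij_witness[of _
      "\<lambda>((a1, b1, c1), (a2, b2, c2), (a3, b3, c3), (a4, b4, c4)). (((a1, a2, a3, a4), (b1, b2, b3, b4)), (c1, c2, c3, c4))"
      "\<lambda>(((a1, a2, a3, a4), (b1, b2, b3, b4)), (c1, c2, c3, c4)). ((a1, b1, c1), (a2, b2, c2), (a3, b3, c3), (a4, b4, c4))"]) auto
  finally show ?thesis ..
qed

lemma qsum_pairing_False: "qsum {..<m} (\<lambda>a b c e. pairing False a b c e * F a b c e) = (\<Sum>a<m. \<Sum>c<m. F a a c c)"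
proof -
  have "qsum {..<m} (\<lambda>a b c e. pairing False a b c e * F a b c e) =
      (\<Sum>a<m. \<Sum>b<m. \<Sum>c<m. \<Sum>e<m. if e = c then (if b = a then F a a c c else 0) else 0)"
    unfolding qsum_nested by (intro sum.cong refl) (auto simp: pairing_def)
  also have "\<dots> = (\<Sum>a<m. \<Sum>b<m. if b = a then \<Sum>c<m. F a a c c else 0)"
    by (intro sum.cong refl) simp
  also have "\<dots> = (\<Sum>a<m. \<Sum>c<m. F a a c c)" by simp
  finally show ?thesis .
qed

lemma qsum_pairing_True: "qsum {..<m} (\<lambda>a b c e. pairing True a b c e * F a b c e) = (\<Sum>a<m. \<Sum>c<m. F a c c a)"
proof -
  have "qsum {..<m} (\<lambda>a b c e. pairing True a b c e * F a b c e) =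
      (\<Sum>a<m. \<Sum>b<m. \<Sum>c<m. \<Sum>e<m. if e = a then (if c = b then F a b b a else 0) else 0)"
    unfolding qsum_nested by (intro sum.cong refl) (auto simp: pairing_def)
  also have "\<dots> = (\<Sum>a<m. \<Sum>b<m. F a b b a)"
    by (intro sum.cong refl) simp
  finally show ?thesis .
qed

text \<open>The Gram matrix of the pairings in dimension m: m to the number of closed loops, two for
  equal pairings and one otherwise.\<close>

definition loop_weight :: "nat \<Rightarrow> bool \<Rightarrow> bool \<Rightarrow> real" where
  "loop_weight m s t = (if s = t then (real m)\<^sup>2 else real m)"

lemma qsum_pairing_pairing:
  "qsum {..<m} (\<lambda>a b c e. pairing s a b c e * pairing t a b c e) = of_real (loop_weight m s t)"
proof -
  have "{..<m} \<inter> {c. a = c \<and> c = a} = {a}" if "a < m" for a using that by auto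
  then have "(\<Sum>a<m. complex_of_nat (card ({..<m} \<inter> {c. a = c \<and> c = a}))) = of_nat m" by simp
  then show ?thesis
    by (cases s; cases t; simp add: qsum_pairing_False qsum_pairing_True)
      (simp_all add: pairing_def loop_weight_def power2_eq_square)
qed

lemma tensor_index_less:
  assumes "a < D" "b < D" "k < d"
  shows "tensor_index D d a b k < D * D * d"
proof -
  have "a * D + b < D * D"
    using assms mult_le_mono1[of "Suc a" D D] by simp
  then have "Suc (a * D + b) * d \<le> D * D * d" by (intro mult_le_mono1) simp
  then show ?thesis using assms by (simp add: tensor_index_def)
qed

lemma tensor_index_eq_iff:
  assumes "b < D" "k < d" "b' < D" "k' < d"
  shows "tensor_index D d a b k = tensor_index D d a' b' k' \<longleftrightarrow> a = a' \<and> b = b' \<and> k = k'"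
proof
  assume *: "tensor_index D d a b k = tensor_index D d a' b' k'"
  then have k: "k = k'" unfolding tensor_index_def using assms by (metis mod_mult_self3 mod_less)
  moreover have ab: "a * D + b = a' * D + b'" using * k assms by (simp add: tensor_index_def)
  moreover have "b = b'" using ab assms by (metis mod_mult_self3 mod_less)
  ultimately show "a = a' \<and> b = b' \<and> k = k'" using assms by simp
qed simp

text \<open>Index equations on the product basis split into the three legs because
  \<open>tensor_index\<close> is injective on the admissible indices.\<close>

lemma pairing_tensor_index:
  assumes "b1 < D" "b2 < D" "b3 < D" "b4 < D" "k1 < d" "k2 < d" "k3 < d" "k4 < d"
  shows "pairing s (tensor_index D d a1 b1 k1) (tensor_index D d a2 b2 k2)
      (tensor_index D d a3 b3 k3) (tensor_index D d a4 b4 k4) =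
    pairing s a1 a2 a3 a4 * pairing s b1 b2 b3 b4 * pairing s k1 k2 k3 k4"
  unfolding pairing_def of_bool_conj[symmetric]
  by (rule arg_cong[where f = of_bool], cases s; simp add: tensor_index_eq_iff assms; blast)

lemma sum_unit_vec:
  fixes \<phi> :: "complex Matrix.vec"
  assumes "\<phi> \<in> carrier_vec d" "\<phi> \<bullet>c \<phi> = (1::complex)"
  shows "(\<Sum>k<d. \<phi> $ k * cnj (\<phi> $ k)) = 1"
  using assms by (simp add: scalar_prod_def atLeast0LessThan)

context haar
begin

text \<open>The input permutation s acts on the row legs \<alpha>, \<beta> and the output
  permutation t on the column legs \<gamma>, \<lambda>, j. The third row leg is closed off by the
  reference vector and leaves no trace.\<close>

lemma site_tensor_moment:
  fixes D d :: nat and \<phi> :: "complex Matrix.vec"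
  assumes n: "n = D * D * d" and D: "D \<ge> 2" and d: "d \<ge> 2"
    and \<phi>: "\<phi> \<in> carrier_vec d" "\<phi> \<bullet>c \<phi> = 1"
    and lt: "a1 < D" "a2 < D" "a3 < D" "a4 < D" "b1 < D" "b2 < D" "b3 < D" "b4 < D"
     "g1 < D" "g2 < D" "g3 < D" "g4 < D" "l1 < D" "l2 < D" "l3 < D" "l4 < D"
     "j1 < d" "j2 < d" "j3 < d" "j4 < d"
  defines "f \<equiv> \<lambda>U. cnj (site_tensor D d \<phi> U a1 b1 g1 l1 j1) * site_tensor D d \<phi> U a2 b2 g2 l2 j2 *
      cnj (site_tensor D d \<phi> U a3 b3 g3 l3 j3) * site_tensor D d \<phi> U a4 b4 g4 l4 j4"
  shows "integrable \<mu> f"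
    and "(\<integral>U. f U \<partial>\<mu>) = (\<Sum>s\<in>UNIV. \<Sum>t\<in>UNIV. of_real (weingarten n s t) *
      (pairing s a1 a2 a3 a4 * pairing s b1 b2 b3 b4) *
      (pairing t g1 g2 g3 g4 * pairing t l1 l2 l3 l4 * pairing t j1 j2 j3 j4))"
proof -
  define c where "c k1 k2 k3 k4 = \<phi> $ k1 * cnj (\<phi> $ k2) * \<phi> $ k3 * cnj (\<phi> $ k4)" for k1 k2 k3 k4
  define m where "m k1 k2 k3 k4 U =
    cnj (U $$ (tensor_index D d a1 b1 k1, tensor_index D d g1 l1 j1)) * U $$ (tensor_index D d a2 b2 k2, tensor_index D d g2 l2 j2) *
    cnj (U $$ (tensor_index D d a3 b3 k3, tensor_index D d g3 l3 j3)) * U $$ (tensor_index D d a4 b4 k4, tensor_index D d g4 l4 j4)"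
    for k1 k2 k3 k4 and U :: "complex mat"
  have f: "f U = qsum {..<d} (\<lambda>k1 k2 k3 k4. c k1 k2 k3 k4 * m k1 k2 k3 k4 U)" for U
    unfolding f_def site_tensor_def cnj_sum prod4_sum c_def m_def by (simp add: mult_ac)
  have m: "integrable \<mu> (m k1 k2 k3 k4)" if "k1 < d" "k2 < d" "k3 < d" "k4 < d" for k1 k2 k3 k4
    unfolding m_def using that lt n by (intro monomial_integrable) (auto simp: tensor_index_less)
  show "integrable \<mu> f"
    unfolding f by (intro integrable_qsum integrable_mult_right m) auto
  have n2: "n \<ge> 2"
    using mult_le_mono[OF mult_le_mono[of 2 D 1 D], of 1 d] D d n by simp
  \<comment> \<open>Either pairing joins the two copies of \<phi> to the two conjugate copies,
    giving the squared norm twice.\<close>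
  have ph: "qsum {..<d} (\<lambda>k1 k2 k3 k4. pairing s k1 k2 k3 k4 * c k1 k2 k3 k4) = 1" for s
  proof (cases s)
    case True
    have "(\<Sum>a<d. \<Sum>e<d. c a e e a) = (\<Sum>k<d. \<phi> $ k * cnj (\<phi> $ k)) * (\<Sum>k<d. \<phi> $ k * cnj (\<phi> $ k))"
      unfolding sum_product by (intro sum.cong refl) (simp add: c_def mult_ac)
    then show ?thesis using True sum_unit_vec[OF \<phi>] by (simp add: qsum_pairing_True)
  next
    case False
    have "(\<Sum>a<d. \<Sum>e<d. c a a e e) = (\<Sum>k<d. \<phi> $ k * cnj (\<phi> $ k)) * (\<Sum>k<d. \<phi> $ k * cnj (\<phi> $ k))"
      unfolding sum_product by (intro sum.cong refl) (simp add: c_def mult_ac)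
    then show ?thesis using False sum_unit_vec[OF \<phi>] by (simp add: qsum_pairing_False)
  qed
  have "(\<integral>U. f U \<partial>\<mu>) = qsum {..<d} (\<lambda>k1 k2 k3 k4. \<integral>U. c k1 k2 k3 k4 * m k1 k2 k3 k4 U \<partial>\<mu>)"
    unfolding f by (intro integral_qsum integrable_mult_right m) auto
  also have "\<dots> = qsum {..<d} (\<lambda>k1 k2 k3 k4. \<Sum>s\<in>UNIV. \<Sum>t\<in>UNIV. (of_real (weingarten n s t) *
      (pairing s a1 a2 a3 a4 * pairing s b1 b2 b3 b4) *
      (pairing t g1 g2 g3 g4 * pairing t l1 l2 l3 l4 * pairing t j1 j2 j3 j4)) * (pairing s k1 k2 k3 k4 * c k1 k2 k3 k4))"
  proof (intro qsum_cong)
    fix k1 k2 k3 k4 assume "k1 \<in> {..<d}" "k2 \<in> {..<d}" "k3 \<in> {..<d}" "k4 \<in> {..<d}"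
    then have k: "k1 < d" "k2 < d" "k3 < d" "k4 < d" by auto
    have "(\<integral>U. c k1 k2 k3 k4 * m k1 k2 k3 k4 U \<partial>\<mu>) = c k1 k2 k3 k4 * (\<integral>U. m k1 k2 k3 k4 U \<partial>\<mu>)"
      by (rule integral_mult_right_zero)
    also have "(\<integral>U. m k1 k2 k3 k4 U \<partial>\<mu>) = (\<Sum>s\<in>UNIV. \<Sum>t\<in>UNIV. of_real (weingarten n s t) *
      pairing s (tensor_index D d a1 b1 k1) (tensor_index D d a2 b2 k2) (tensor_index D d a3 b3 k3) (tensor_index D d a4 b4 k4) *
      pairing t (tensor_index D d g1 l1 j1) (tensor_index D d g2 l2 j2) (tensor_index D d g3 l3 j3) (tensor_index D d g4 l4 j4))"
      unfolding m_def by (subst moment_weingarten[OF n2, symmetric])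
        (use lt k n in \<open>auto simp: tensor_index_less moment_def\<close>)
    also have "c k1 k2 k3 k4 * \<dots> = (\<Sum>s\<in>UNIV. \<Sum>t\<in>UNIV. (of_real (weingarten n s t) *
      (pairing s a1 a2 a3 a4 * pairing s b1 b2 b3 b4) *
      (pairing t g1 g2 g3 g4 * pairing t l1 l2 l3 l4 * pairing t j1 j2 j3 j4)) * (pairing s k1 k2 k3 k4 * c k1 k2 k3 k4))"
      unfolding sum_distrib_left
      by (intro sum.cong refl) (simp only: pairing_tensor_index lt k mult_ac)
    finally show "(\<integral>U. c k1 k2 k3 k4 * m k1 k2 k3 k4 U \<partial>\<mu>) = \<dots>" .
  qed
  also have "\<dots> = (\<Sum>s\<in>UNIV. \<Sum>t\<in>UNIV. of_real (weingarten n s t) *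
      (pairing s a1 a2 a3 a4 * pairing s b1 b2 b3 b4) *
      (pairing t g1 g2 g3 g4 * pairing t l1 l2 l3 l4 * pairing t j1 j2 j3 j4))"
    unfolding qsum_sum qsum_mult_left[symmetric] ph by simp
  finally show "(\<integral>U. f U \<partial>\<mu>) = \<dots>" .
qed

end

section \<open>The squared expectation value as a sum over four index configurations\<close>

locale random_tn = haar \<mu> "D * D * d" for \<mu> :: "complex mat measure" and D d :: nat +
  fixes L :: nat and \<phi> :: "complex Matrix.vec" and Ob :: "complex mat" and v :: site
  assumes D: "D \<ge> 2" and d: "d \<ge> 2"
    and \<phi>: "\<phi> \<in> carrier_vec d" "\<phi> \<bullet>c \<phi> = 1"
    and Ob: "Ob \<in> carrier_mat d d" "hermitian_mat Ob" "mat_trace Ob = 0"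
    and v: "v \<in> sites L"
begin

abbreviation "S \<equiv> sites L"

definition "X = {..<D} \<times> {..<D} \<times> {..<d}"

text \<open>A configuration x stores at each site the indices (\<alpha>, \<beta>, j) that it owns;
  \<gamma> and \<lambda> are read off the upper and right neighbours, so each bond index is stored
  once.\<close>

definition site_amp :: "(site \<Rightarrow> nat \<times> nat \<times> nat) \<Rightarrow> site \<Rightarrow> complex mat \<Rightarrow> complex" where
  "site_amp x u M = site_tensor D d \<phi> M (fst (x u)) (fst (snd (x u)))
     (fst (x (up L u))) (fst (snd (x (right L u)))) (snd (snd (x u)))"

definition amp :: "(site \<Rightarrow> nat \<times> nat \<times> nat) \<Rightarrow> (site \<Rightarrow> complex mat) \<Rightarrow> complex" where
  "amp x U = (\<Prod>u\<in>S. site_amp x u (U u))"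

text \<open>Makes the observable a product over all sites, with the identity away from v, so that it
  factorizes like the amplitudes.\<close>

definition ob_entry :: "site \<Rightarrow> nat \<Rightarrow> nat \<Rightarrow> complex" where
  "ob_entry u j k = (if u = v then Ob $$ (j, k) else of_bool (j = k))"

definition ob_config :: "(site \<Rightarrow> nat) \<Rightarrow> (site \<Rightarrow> nat) \<Rightarrow> complex" where
  "ob_config j k = (\<Prod>u\<in>S. ob_entry u (j u) (k u))"

definition phys :: "(site \<Rightarrow> nat \<times> nat \<times> nat) \<Rightarrow> site \<Rightarrow> nat" where
  "phys x = (\<lambda>u\<in>S. snd (snd (x u)))"

lemma finite_X [simp]: "finite X" by (simp add: X_def)

lemma phys_configs:
  assumes "x \<in> S \<rightarrow>\<^sub>E X"
  shows "phys x \<in> configs L d"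
  unfolding phys_def configs_def
proof (intro restrict_PiE_iff[THEN iffD2] ballI)
  fix u assume "u \<in> S"
  with assms have "x u \<in> X" by (rule PiE_mem)
  then show "snd (snd (x u)) \<in> {..<d}" by (auto simp: X_def)
qed

lemma sum_tn_state:
  "(\<Sum>j\<in>configs L d. F j * tn_state D d L \<phi> U j) = (\<Sum>x\<in>S \<rightarrow>\<^sub>E X. F (phys x) * amp x U)"
proof -
  have "(\<Sum>j\<in>configs L d. F j * tn_state D d L \<phi> U j) =
     (\<Sum>(j, a, b)\<in>configs L d \<times> configs L D \<times> configs L D. F j * (\<Prod>u\<in>S.
        site_tensor D d \<phi> (U u) (a u) (b u) (a (up L u)) (b (right L u)) (j u)))"
    unfolding tn_state_def sum_distrib_left sum.cartesian_product
    by (intro sum.cong refl) (simp add: case_prod_beta up_def right_def)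
  also have "\<dots> = (\<Sum>x\<in>S \<rightarrow>\<^sub>E X. F (phys x) * amp x U)"
  proof (rule sum.reindex_bij_witness[of _
        "\<lambda>x. (phys x, \<lambda>u\<in>S. fst (x u), \<lambda>u\<in>S. fst (snd (x u)))"
        "\<lambda>(j, a, b). \<lambda>u\<in>S. (a u, b u, j u)"])
    fix x assume x: "x \<in> S \<rightarrow>\<^sub>E X"
    show "(phys x, \<lambda>u\<in>S. fst (x u), \<lambda>u\<in>S. fst (snd (x u))) \<in> configs L d \<times> configs L D \<times> configs L D"
      using x by (force simp: phys_def configs_def X_def)
    show "(case (phys x, \<lambda>u\<in>S. fst (x u), \<lambda>u\<in>S. fst (snd (x u))) of (j, a, b) \<Rightarrow> \<lambda>u\<in>S. (a u, b u, j u)) = x"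
      using x by (auto simp: phys_def fun_eq_iff PiE_def extensional_def)
  next
    fix y assume "y \<in> configs L d \<times> configs L D \<times> configs L D"
    then obtain j a b where y: "y = (j, a, b)" "j \<in> S \<rightarrow>\<^sub>E {..<d}" "a \<in> S \<rightarrow>\<^sub>E {..<D}" "b \<in> S \<rightarrow>\<^sub>E {..<D}"
      by (auto simp: configs_def)
    let ?x = "\<lambda>u\<in>S. (a u, b u, j u)"
    have j: "phys ?x = j"
      using y(2) by (auto simp: phys_def fun_eq_iff PiE_def extensional_def)
    have a: "(\<lambda>u\<in>S. fst (?x u)) = a"
      using y(3) by (auto simp: fun_eq_iff PiE_def extensional_def)
    have b: "(\<lambda>u\<in>S. fst (snd (?x u))) = b"
      using y(4) by (auto simp: fun_eq_iff PiE_def extensional_def)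
    show "(phys (case y of (j, a, b) \<Rightarrow> \<lambda>u\<in>S. (a u, b u, j u)),
        \<lambda>u\<in>S. fst ((case y of (j, a, b) \<Rightarrow> \<lambda>u\<in>S. (a u, b u, j u)) u),
        \<lambda>u\<in>S. fst (snd ((case y of (j, a, b) \<Rightarrow> \<lambda>u\<in>S. (a u, b u, j u)) u))) = y"
      unfolding y prod.case a b j ..
    show "(case y of (j, a, b) \<Rightarrow> \<lambda>u\<in>S. (a u, b u, j u)) \<in> S \<rightarrow>\<^sub>E X"
      using y by (auto simp: X_def)
    have "(\<Prod>u\<in>S. site_tensor D d \<phi> (U u) (a u) (b u) (a (up L u)) (b (right L u)) (j u)) = amp ?x U"
      unfolding amp_def site_amp_def
      by (intro prod.cong refl) (simp add: up_in_sites right_in_sites)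
    then show "F (phys (case y of (j, a, b) \<Rightarrow> \<lambda>u\<in>S. (a u, b u, j u))) *
        amp (case y of (j, a, b) \<Rightarrow> \<lambda>u\<in>S. (a u, b u, j u)) U =
      (case y of (j, a, b) \<Rightarrow> F j * (\<Prod>u\<in>S.
        site_tensor D d \<phi> (U u) (a u) (b u) (a (up L u)) (b (right L u)) (j u)))"
      unfolding y prod.case j by simp
  qed
  finally show ?thesis .
qed

lemma sum_cnj_tn_state:
  "(\<Sum>j\<in>configs L d. cnj (tn_state D d L \<phi> U j) * F j) = (\<Sum>x\<in>S \<rightarrow>\<^sub>E X. cnj (amp x U) * F (phys x))"
proof -
  have "cnj (\<Sum>j\<in>configs L d. cnj (F j) * tn_state D d L \<phi> U j) = cnj (\<Sum>x\<in>S \<rightarrow>\<^sub>E X. cnj (F (phys x)) * amp x U)"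
    by (rule arg_cong[OF sum_tn_state])
  then show ?thesis unfolding cnj_sum complex_cnj_mult complex_cnj_cnj by (simp only: mult.commute)
qed

text \<open>The matrix element between j and k vanishes unless they agree off v, so only the updates
  \<open>j(v := k)\<close> survive.\<close>

lemma apply_at_eq:
  assumes j: "j \<in> configs L d"
  shows "apply_at d Ob v \<Psi> j = (\<Sum>k\<in>configs L d. ob_config j k * \<Psi> k)"
proof -
  have in_configs: "j(v := k) \<in> configs L d" if "k < d" for k
    using j v that by (auto simp: configs_def PiE_def extensional_def)
  have ob: "ob_config j (j(v := k)) = Ob $$ (j v, k)" for k
  proof -
    have "ob_config j (j(v := k)) = (\<Prod>u\<in>{v}. ob_entry u (j u) ((j(v := k)) u))"
      unfolding ob_config_def using v by (intro prod.mono_neutral_right) (auto simp: ob_entry_def)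
    then show ?thesis by (simp add: ob_entry_def)
  qed
  have "(\<Sum>k\<in>configs L d. ob_config j k * \<Psi> k) = (\<Sum>k\<in>(\<lambda>k. j(v := k)) ` {..<d}. ob_config j k * \<Psi> k)"
  proof (rule sum.mono_neutral_right)
    show "finite (configs L d)" by (simp add: configs_def finite_PiE)
    show "(\<lambda>k. j(v := k)) ` {..<d} \<subseteq> configs L d" using in_configs by auto
    show "\<forall>k\<in>configs L d - (\<lambda>k. j(v := k)) ` {..<d}. ob_config j k * \<Psi> k = 0"
    proof
      fix k assume k: "k \<in> configs L d - (\<lambda>k. j(v := k)) ` {..<d}"
      then have kv: "k v < d" using v by (auto simp: configs_def)
      have "\<exists>u\<in>S. u \<noteq> v \<and> j u \<noteq> k u"
      proof (rule ccontr)
        assume "\<not> ?thesis"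
        then have "k = j(v := k v)"
          using k j v by (intro ext) (force simp: configs_def PiE_def extensional_def)
        then show False using k kv by (metis DiffD2 image_eqI lessThan_iff)
      qed
      then obtain u where "u \<in> S" "u \<noteq> v" "j u \<noteq> k u" by blast
      then have "ob_config j k = 0"
        unfolding ob_config_def by (intro prod_zero bexI[of _ u]) (auto simp: ob_entry_def)
      then show "ob_config j k * \<Psi> k = 0" by simp
    qed
  qed
  also have "\<dots> = (\<Sum>k<d. ob_config j (j(v := k)) * \<Psi> (j(v := k)))"
    by (rule sum.reindex_cong[of "\<lambda>k. j(v := k)"]) (auto simp: inj_on_def dest: fun_upd_eqD)
  finally show ?thesis by (simp add: ob apply_at_def)
qed

lemma expval_eq:
  "expval d L Ob v (tn_state D d L \<phi> U) =
    (\<Sum>x\<in>S \<rightarrow>\<^sub>E X. \<Sum>y\<in>S \<rightarrow>\<^sub>E X. ob_config (phys x) (phys y) * (cnj (amp x U) * amp y U))"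
proof -
  have "expval d L Ob v (tn_state D d L \<phi> U) =
     (\<Sum>j\<in>configs L d. cnj (tn_state D d L \<phi> U j) * (\<Sum>y\<in>S \<rightarrow>\<^sub>E X. ob_config j (phys y) * amp y U))"
    unfolding expval_def by (intro sum.cong refl) (simp add: apply_at_eq sum_tn_state)
  also have "\<dots> = (\<Sum>x\<in>S \<rightarrow>\<^sub>E X. cnj (amp x U) * (\<Sum>y\<in>S \<rightarrow>\<^sub>E X. ob_config (phys x) (phys y) * amp y U))"
    by (rule sum_cnj_tn_state)
  finally show ?thesis by (simp add: sum_distrib_left mult_ac)
qed

lemma cnj_Ob: "j < d \<Longrightarrow> k < d \<Longrightarrow> cnj (Ob $$ (j, k)) = Ob $$ (k, j)"
  using mat_adjoint_index[OF Ob(1), of k j] Ob(2) by (simp add: hermitian_mat_def)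

text \<open>Hermiticity of \<open>Ob\<close> exchanges the two configurations. A real expectation
  value allows its plain square to replace the squared modulus in the Markov bound.\<close>

lemma cnj_expval: "cnj (expval d L Ob v (tn_state D d L \<phi> U)) = expval d L Ob v (tn_state D d L \<phi> U)"
proof -
  have q: "cnj (ob_config (phys x) (phys y)) = ob_config (phys y) (phys x)"
    if "x \<in> S \<rightarrow>\<^sub>E X" "y \<in> S \<rightarrow>\<^sub>E X" for x y
    unfolding ob_config_def cnj_prod
  proof (intro prod.cong refl)
    fix u assume "u \<in> S"
    then have "phys x u < d" "phys y u < d"
      using phys_configs[OF that(1)] phys_configs[OF that(2)] by (auto simp: configs_def)
    then show "cnj (ob_entry u (phys x u) (phys y u)) = ob_entry u (phys y u) (phys x u)"
      by (auto simp: ob_entry_def cnj_Ob)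
  qed
  have "cnj (expval d L Ob v (tn_state D d L \<phi> U)) =
    (\<Sum>x\<in>S \<rightarrow>\<^sub>E X. \<Sum>y\<in>S \<rightarrow>\<^sub>E X. ob_config (phys y) (phys x) * (cnj (amp y U) * amp x U))"
    unfolding expval_eq cnj_sum by (intro sum.cong refl) (simp add: q mult_ac)
  also have "\<dots> = expval d L Ob v (tn_state D d L \<phi> U)"
    unfolding expval_eq by (rule sum.swap)
  finally show ?thesis .
qed

definition gate where
  "gate x1 x2 x3 bond_dim_power u M = cnj (site_amp x1 u M) * site_amp x2 u M * cnj (site_amp x3 u M) * site_amp bond_dim_power u M"

definition ob_pair :: "site \<Rightarrow> nat \<Rightarrow> nat \<Rightarrow> nat \<Rightarrow> nat \<Rightarrow> complex" where
  "ob_pair u j1 j2 j3 j4 = ob_entry u j1 j2 * ob_entry u j3 j4"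

lemma expval_square:
  "(expval d L Ob v (tn_state D d L \<phi> U))\<^sup>2 = qsum (S \<rightarrow>\<^sub>E X) (\<lambda>x1 x2 x3 bond_dim_power.
     (\<Prod>u\<in>S. ob_pair u (snd (snd (x1 u))) (snd (snd (x2 u))) (snd (snd (x3 u))) (snd (snd (bond_dim_power u)))) *
     (\<Prod>u\<in>S. gate x1 x2 x3 bond_dim_power u (U u)))"
proof -
  have "(expval d L Ob v (tn_state D d L \<phi> U))\<^sup>2 = qsum (S \<rightarrow>\<^sub>E X) (\<lambda>x1 x2 x3 bond_dim_power.
     ob_config (phys x1) (phys x2) * (cnj (amp x1 U) * amp x2 U) *
     (ob_config (phys x3) (phys bond_dim_power) * (cnj (amp x3 U) * amp bond_dim_power U)))"
    unfolding power2_eq_square expval_eq qsum_nested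
    by (simp only: sum_distrib_left[symmetric] sum_distrib_right[symmetric])
  also have "\<dots> = qsum (S \<rightarrow>\<^sub>E X) (\<lambda>x1 x2 x3 bond_dim_power.
     (\<Prod>u\<in>S. ob_pair u (snd (snd (x1 u))) (snd (snd (x2 u))) (snd (snd (x3 u))) (snd (snd (bond_dim_power u)))) *
     (\<Prod>u\<in>S. gate x1 x2 x3 bond_dim_power u (U u)))"
    by (intro qsum_cong)
      (simp add: ob_config_def amp_def gate_def ob_pair_def prod.distrib phys_def mult_ac)
  finally show ?thesis .
qed

lemma gate_moment:
  assumes x: "x1 \<in> S \<rightarrow>\<^sub>E X" "x2 \<in> S \<rightarrow>\<^sub>E X" "x3 \<in> S \<rightarrow>\<^sub>E X" "bond_dim_power \<in> S \<rightarrow>\<^sub>E X" and u: "u \<in> S"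
  shows "integrable \<mu> (gate x1 x2 x3 bond_dim_power u)"
    and "(\<integral>M. gate x1 x2 x3 bond_dim_power u M \<partial>\<mu>) = (\<Sum>s\<in>UNIV. \<Sum>t\<in>UNIV. of_real (weingarten (D * D * d) s t) *
      (pairing s (fst (x1 u)) (fst (x2 u)) (fst (x3 u)) (fst (bond_dim_power u)) *
       pairing s (fst (snd (x1 u))) (fst (snd (x2 u))) (fst (snd (x3 u))) (fst (snd (bond_dim_power u)))) *
      (pairing t (fst (x1 (up L u))) (fst (x2 (up L u))) (fst (x3 (up L u))) (fst (bond_dim_power (up L u))) *
       pairing t (fst (snd (x1 (right L u)))) (fst (snd (x2 (right L u)))) (fst (snd (x3 (right L u)))) (fst (snd (bond_dim_power (right L u)))) *
       pairing t (snd (snd (x1 u))) (snd (snd (x2 u))) (snd (snd (x3 u))) (snd (snd (bond_dim_power u)))))"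
proof -
  have lt: "fst (x w) < D" "fst (snd (x w)) < D" "snd (snd (x w)) < d"
    if "x \<in> S \<rightarrow>\<^sub>E X" "w \<in> S" for x w
    using PiE_mem[OF that] by (auto simp: X_def)
  note lts = lt[OF x(1) u] lt[OF x(2) u] lt[OF x(3) u] lt[OF x(4) u]
    lt(1)[OF x(1) up_in_sites[OF u]] lt(1)[OF x(2) up_in_sites[OF u]] lt(1)[OF x(3) up_in_sites[OF u]] lt(1)[OF x(4) up_in_sites[OF u]]
    lt(2)[OF x(1) right_in_sites[OF u]] lt(2)[OF x(2) right_in_sites[OF u]] lt(2)[OF x(3) right_in_sites[OF u]] lt(2)[OF x(4) right_in_sites[OF u]]
  show "integrable \<mu> (gate x1 x2 x3 bond_dim_power u)"
    unfolding gate_def site_amp_def by (intro site_tensor_moment(1) refl D d \<phi> lts)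
  show "(\<integral>M. gate x1 x2 x3 bond_dim_power u M \<partial>\<mu>) = (\<Sum>s\<in>UNIV. \<Sum>t\<in>UNIV. of_real (weingarten (D * D * d) s t) *
      (pairing s (fst (x1 u)) (fst (x2 u)) (fst (x3 u)) (fst (bond_dim_power u)) *
       pairing s (fst (snd (x1 u))) (fst (snd (x2 u))) (fst (snd (x3 u))) (fst (snd (bond_dim_power u)))) *
      (pairing t (fst (x1 (up L u))) (fst (x2 (up L u))) (fst (x3 (up L u))) (fst (bond_dim_power (up L u))) *
       pairing t (fst (snd (x1 (right L u)))) (fst (snd (x2 (right L u)))) (fst (snd (x3 (right L u)))) (fst (snd (bond_dim_power (right L u)))) *
       pairing t (snd (snd (x1 u))) (snd (snd (x2 u))) (snd (snd (x3 u))) (snd (snd (bond_dim_power u)))))"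
    unfolding gate_def site_amp_def by (intro site_tensor_moment(2) refl D d \<phi> lts)
qed

end

section \<open>The second moment as a partition function of permutations\<close>

context random_tn
begin

definition ob_norm :: real where "ob_norm = Re (mat_trace (Ob * Ob))"

text \<open>The physical leg contracted with pairing t: at v these are (Tr O)^2 = 0 and Tr(O^2),
  elsewhere the two loop weights d^2 and d.\<close>

definition phys_weight :: "site \<Rightarrow> bool \<Rightarrow> real" where
  "phys_weight u t = (if u = v then (if t then ob_norm else 0) else (if t then real d else (real d)\<^sup>2))"

text \<open>The output permutation t of u meets the input permutations p and r of the upper and
  right neighbours on the bonds \<gamma> and \<lambda>, and its own s through the Weingarten
  coefficient. Once s, p, r are fixed, t can be summed locally.\<close>

definition site_weight :: "site \<Rightarrow> bool \<Rightarrow> bool \<Rightarrow> bool \<Rightarrow> real" where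
  "site_weight u s p r = (\<Sum>t\<in>UNIV. weingarten (D * D * d) s t * loop_weight D p t * loop_weight D r t * phys_weight u t)"

lemma trace_square: "mat_trace (Ob * Ob) = (\<Sum>a<d. \<Sum>c<d. Ob $$ (a, c) * Ob $$ (c, a))"
  using Ob(1) by (simp add: mat_trace_def mult_mat_index_sum[OF Ob(1) Ob(1)] del: index_mult_mat(1))

lemma ob_norm_eq: "ob_norm = (\<Sum>a<d. \<Sum>c<d. (cmod (Ob $$ (a, c)))\<^sup>2)"
  and trace_square_ob_norm: "mat_trace (Ob * Ob) = of_real ob_norm"
proof -
  have *: "mat_trace (Ob * Ob) = of_real (\<Sum>a<d. \<Sum>c<d. (cmod (Ob $$ (a, c)))\<^sup>2)"
    unfolding trace_square of_real_sum
    by (intro sum.cong refl) (simp only: complex_norm_square cnj_Ob lessThan_iff)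
  show 1: "ob_norm = (\<Sum>a<d. \<Sum>c<d. (cmod (Ob $$ (a, c)))\<^sup>2)"
    unfolding ob_norm_def * by (rule Re_complex_of_real)
  show "mat_trace (Ob * Ob) = of_real ob_norm"
    unfolding 1 by (rule *)
qed

lemma ob_norm_nonneg: "0 \<le> ob_norm"
  unfolding ob_norm_eq by (intro sum_nonneg) simp

lemma qsum_ob_pair:
  "qsum {..<d} (\<lambda>a b c e. pairing t a b c e * ob_pair u a b c e) = of_real (phys_weight u t)"
proof (cases "u = v")
  case True
  have "(\<Sum>a<d. \<Sum>c<d. Ob $$ (a, a) * Ob $$ (c, c)) = mat_trace Ob * mat_trace Ob"
    using Ob(1) by (simp add: mat_trace_def sum_product)
  then show ?thesis
    using True trace_square trace_square_ob_norm Ob(3)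
    by (cases t) (simp_all add: qsum_pairing_False qsum_pairing_True ob_pair_def ob_entry_def phys_weight_def)
next
  case False
  have "{..<d} \<inter> {c. a = c \<and> c = a} = {a}" if "a < d" for a using that by auto
  then have *: "(\<Sum>a<d. complex_of_nat (card ({..<d} \<inter> {c. a = c \<and> c = a}))) = of_nat d" by simp
  show ?thesis
  proof (cases t)
    case True
    then show ?thesis using False *
      by (simp add: qsum_pairing_True ob_pair_def ob_entry_def phys_weight_def flip: of_bool_conj)
  next
    case t: False
    then show ?thesis using False
      by (simp add: qsum_pairing_False ob_pair_def ob_entry_def phys_weight_def power2_eq_square)
  qed
qed

definition gate_weight where
  "gate_weight x1 x2 x3 bond_dim_power u s t =
     (of_real (weingarten (D * D * d) s t) *
      (pairing s (fst (x1 u)) (fst (x2 u)) (fst (x3 u)) (fst (bond_dim_power u)) *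
       pairing s (fst (snd (x1 u))) (fst (snd (x2 u))) (fst (snd (x3 u))) (fst (snd (bond_dim_power u)))) *
      (pairing t (fst (x1 (up L u))) (fst (x2 (up L u))) (fst (x3 (up L u))) (fst (bond_dim_power (up L u))) *
       pairing t (fst (snd (x1 (right L u)))) (fst (snd (x2 (right L u)))) (fst (snd (x3 (right L u)))) (fst (snd (bond_dim_power (right L u)))) *
       pairing t (snd (snd (x1 u))) (snd (snd (x2 u))) (snd (snd (x3 u))) (snd (snd (bond_dim_power u))))) *
      ob_pair u (snd (snd (x1 u))) (snd (snd (x2 u))) (snd (snd (x3 u))) (snd (snd (bond_dim_power u)))"

text \<open>Under the product measure the sites are independent, so the integral of a product of
  gates is the product of their moments.\<close>

lemma integral_expval_square:
  "integrable (\<Pi>\<^sub>M u\<in>S. \<mu>) (\<lambda>U. (expval d L Ob v (tn_state D d L \<phi> U))\<^sup>2)" (is ?int)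
  "(\<integral>U. (expval d L Ob v (tn_state D d L \<phi> U))\<^sup>2 \<partial>(\<Pi>\<^sub>M u\<in>S. \<mu>)) =
    qsum (S \<rightarrow>\<^sub>E X) (\<lambda>x1 x2 x3 bond_dim_power. \<Prod>u\<in>S. \<Sum>s\<in>UNIV. \<Sum>t\<in>UNIV. gate_weight x1 x2 x3 bond_dim_power u s t)" (is ?eq)
proof -
  interpret P: product_sigma_finite "\<lambda>_::site. \<mu>"
    by (intro product_sigma_finite.intro sigma_finite_measure_axioms)
  have int: "integrable (\<Pi>\<^sub>M u\<in>S. \<mu>) (\<lambda>U. \<Prod>u\<in>S. gate x1 x2 x3 bond_dim_power u (U u))"
    if "x1 \<in> S \<rightarrow>\<^sub>E X" "x2 \<in> S \<rightarrow>\<^sub>E X" "x3 \<in> S \<rightarrow>\<^sub>E X" "bond_dim_power \<in> S \<rightarrow>\<^sub>E X" for x1 x2 x3 bond_dim_power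
    using that by (intro P.product_integrable_prod finite_sites gate_moment(1))
  show ?int
    unfolding expval_square by (intro integrable_qsum integrable_mult_right int)
  have "(\<integral>U. (expval d L Ob v (tn_state D d L \<phi> U))\<^sup>2 \<partial>(\<Pi>\<^sub>M u\<in>S. \<mu>)) =
    qsum (S \<rightarrow>\<^sub>E X) (\<lambda>x1 x2 x3 bond_dim_power. \<integral>U.
      (\<Prod>u\<in>S. ob_pair u (snd (snd (x1 u))) (snd (snd (x2 u))) (snd (snd (x3 u))) (snd (snd (bond_dim_power u)))) *
      (\<Prod>u\<in>S. gate x1 x2 x3 bond_dim_power u (U u)) \<partial>(\<Pi>\<^sub>M u\<in>S. \<mu>))"
    unfolding expval_square by (intro integral_qsum integrable_mult_right int)
  also have "\<dots> = qsum (S \<rightarrow>\<^sub>E X) (\<lambda>x1 x2 x3 bond_dim_power. \<Prod>u\<in>S. \<Sum>s\<in>UNIV. \<Sum>t\<in>UNIV. gate_weight x1 x2 x3 bond_dim_power u s t)"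
  proof (intro qsum_cong)
    fix x1 x2 x3 bond_dim_power assume x: "x1 \<in> S \<rightarrow>\<^sub>E X" "x2 \<in> S \<rightarrow>\<^sub>E X" "x3 \<in> S \<rightarrow>\<^sub>E X" "bond_dim_power \<in> S \<rightarrow>\<^sub>E X"
    let ?o = "\<lambda>u. ob_pair u (snd (snd (x1 u))) (snd (snd (x2 u))) (snd (snd (x3 u))) (snd (snd (bond_dim_power u)))"
    have "(\<integral>U. (\<Prod>u\<in>S. ?o u) * (\<Prod>u\<in>S. gate x1 x2 x3 bond_dim_power u (U u)) \<partial>(\<Pi>\<^sub>M u\<in>S. \<mu>)) =
      (\<Prod>u\<in>S. ?o u) * (\<integral>U. (\<Prod>u\<in>S. gate x1 x2 x3 bond_dim_power u (U u)) \<partial>(\<Pi>\<^sub>M u\<in>S. \<mu>))"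
      by (rule integral_mult_right_zero)
    also have "(\<integral>U. (\<Prod>u\<in>S. gate x1 x2 x3 bond_dim_power u (U u)) \<partial>(\<Pi>\<^sub>M u\<in>S. \<mu>)) =
      (\<Prod>u\<in>S. \<integral>M. gate x1 x2 x3 bond_dim_power u M \<partial>\<mu>)"
      using x by (intro P.product_integral_prod finite_sites gate_moment(1))
    also have "(\<Prod>u\<in>S. ?o u) * \<dots> = (\<Prod>u\<in>S. (\<integral>M. gate x1 x2 x3 bond_dim_power u M \<partial>\<mu>) * ?o u)"
      by (simp only: prod.distrib mult.commute)
    also have "\<dots> = (\<Prod>u\<in>S. \<Sum>s\<in>UNIV. \<Sum>t\<in>UNIV. gate_weight x1 x2 x3 bond_dim_power u s t)"
      by (intro prod.cong refl) (simp only: gate_moment(2)[OF x] sum_distrib_right gate_weight_def)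
    finally show "(\<integral>U. (\<Prod>u\<in>S. ?o u) * (\<Prod>u\<in>S. gate x1 x2 x3 bond_dim_power u (U u)) \<partial>(\<Pi>\<^sub>M u\<in>S. \<mu>)) = \<dots>" .
  qed
  finally show ?eq .
qed

text \<open>Collecting the factors by bonds instead of sites turns each bond into a loop weight.\<close>

lemma qsum_gate_weight:
  "qsum (S \<rightarrow>\<^sub>E X) (\<lambda>x1 x2 x3 bond_dim_power. \<Prod>u\<in>S. gate_weight x1 x2 x3 bond_dim_power u (u \<in> K) (u \<in> J)) =
    of_real (\<Prod>u\<in>S. weingarten (D * D * d) (u \<in> K) (u \<in> J) *
      loop_weight D (up L u \<in> K) (u \<in> J) * loop_weight D (right L u \<in> K) (u \<in> J) * phys_weight u (u \<in> J))"
proof -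
  \<comment> \<open>The bond \<alpha> of u is the bond \<gamma> of \<open>dn u\<close>, and \<beta>
    of u is \<lambda> of \<open>lf u\<close>. Reindexing along both shifts brings the two pairings
    of each bond to one site, and undoing it restores the form with \<open>up\<close> and
    \<open>right\<close>.\<close>
  define dn where "dn = inv_into S (up L)"
  define lf where "lf = inv_into S (right L)"
  have dn: "dn (up L u) = u" and lf: "lf (right L u) = u" if "u \<in> S" for u
    using bij_betw_inv_into_left[OF bij_up that] bij_betw_inv_into_left[OF bij_right that]
    by (simp_all add: dn_def lf_def)
  have re_up: "(\<Prod>u\<in>S. g u (up L u)) = (\<Prod>u\<in>S. g (dn u) u)" for g :: "site \<Rightarrow> site \<Rightarrow> complex"
  proof -
    have "(\<Prod>u\<in>S. g u (up L u)) = (\<Prod>u\<in>S. g (dn (up L u)) (up L u))"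
      by (intro prod.cong refl) (simp add: dn)
    also have "\<dots> = (\<Prod>u\<in>S. g (dn u) u)"
      by (rule prod.reindex_bij_betw[OF bij_up])
    finally show ?thesis .
  qed
  have re_right: "(\<Prod>u\<in>S. g u (right L u)) = (\<Prod>u\<in>S. g (lf u) u)" for g :: "site \<Rightarrow> site \<Rightarrow> complex"
  proof -
    have "(\<Prod>u\<in>S. g u (right L u)) = (\<Prod>u\<in>S. g (lf (right L u)) (right L u))"
      by (intro prod.cong refl) (simp add: lf)
    also have "\<dots> = (\<Prod>u\<in>S. g (lf u) u)"
      by (rule prod.reindex_bij_betw[OF bij_right])
    finally show ?thesis .
  qed
  define f where "f u z1 z2 z3 z4 = pairing (u \<in> K) z1 z2 z3 z4 * pairing (dn u \<in> J) z1 z2 z3 z4" for u z1 z2 z3 z4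
  define g where "g u z1 z2 z3 z4 = pairing (u \<in> K) z1 z2 z3 z4 * pairing (lf u \<in> J) z1 z2 z3 z4" for u z1 z2 z3 z4
  define h where "h u z1 z2 z3 z4 = pairing (u \<in> J) z1 z2 z3 z4 * ob_pair u z1 z2 z3 z4" for u z1 z2 z3 z4
  define wg where "wg u = complex_of_real (weingarten (D * D * d) (u \<in> K) (u \<in> J))" for u
  have "(\<Prod>u\<in>S. gate_weight x1 x2 x3 bond_dim_power u (u \<in> K) (u \<in> J)) = (\<Prod>u\<in>S. wg u * (
      f u (fst (x1 u)) (fst (x2 u)) (fst (x3 u)) (fst (bond_dim_power u)) *
      g u (fst (snd (x1 u))) (fst (snd (x2 u))) (fst (snd (x3 u))) (fst (snd (bond_dim_power u))) *
      h u (snd (snd (x1 u))) (snd (snd (x2 u))) (snd (snd (x3 u))) (snd (snd (bond_dim_power u)))))" for x1 x2 x3 bond_dim_power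
    unfolding gate_weight_def prod.distrib f_def g_def h_def wg_def
      re_up[of "\<lambda>u w. pairing (u \<in> J) (fst (x1 w)) (fst (x2 w)) (fst (x3 w)) (fst (bond_dim_power w))"]
      re_right[of "\<lambda>u w. pairing (u \<in> J) (fst (snd (x1 w))) (fst (snd (x2 w))) (fst (snd (x3 w))) (fst (snd (bond_dim_power w)))"]
    by (simp only: mult_ac)
  then have "qsum (S \<rightarrow>\<^sub>E X) (\<lambda>x1 x2 x3 bond_dim_power. \<Prod>u\<in>S. gate_weight x1 x2 x3 bond_dim_power u (u \<in> K) (u \<in> J)) =
    qsum (S \<rightarrow>\<^sub>E X) (\<lambda>x1 x2 x3 bond_dim_power. \<Prod>u\<in>S. wg u * (
      f u (fst (x1 u)) (fst (x2 u)) (fst (x3 u)) (fst (bond_dim_power u)) *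
      g u (fst (snd (x1 u))) (fst (snd (x2 u))) (fst (snd (x3 u))) (fst (snd (bond_dim_power u))) *
      h u (snd (snd (x1 u))) (snd (snd (x2 u))) (snd (snd (x3 u))) (snd (snd (bond_dim_power u)))))"
    by simp
  also have "\<dots> = (\<Prod>u\<in>S. qsum X (\<lambda>z1 z2 z3 z4. wg u * (
      f u (fst z1) (fst z2) (fst z3) (fst z4) *
      g u (fst (snd z1)) (fst (snd z2)) (fst (snd z3)) (fst (snd z4)) *
      h u (snd (snd z1)) (snd (snd z2)) (snd (snd z3)) (snd (snd z4)))))"
    by (rule prod_qsum_PiE[symmetric]) auto
  also have "\<dots> = (\<Prod>u\<in>S. wg u * of_real (loop_weight D (u \<in> K) (dn u \<in> J)) *
      of_real (loop_weight D (u \<in> K) (lf u \<in> J)) * of_real (phys_weight u (u \<in> J)))"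
    unfolding qsum_mult_left[symmetric] X_def qsum_triple
    unfolding f_def g_def h_def qsum_pairing_pairing qsum_ob_pair by (simp only: mult.assoc)
  also have "\<dots> = of_real (\<Prod>u\<in>S. weingarten (D * D * d) (u \<in> K) (u \<in> J) *
      loop_weight D (up L u \<in> K) (u \<in> J) * loop_weight D (right L u \<in> K) (u \<in> J) * phys_weight u (u \<in> J))"
    unfolding prod.distrib wg_def of_real_prod of_real_mult
      re_up[of "\<lambda>u w. complex_of_real (loop_weight D (w \<in> K) (u \<in> J))"]
      re_right[of "\<lambda>u w. complex_of_real (loop_weight D (w \<in> K) (u \<in> J))"] ..
  finally show ?thesis .
qed

lemma second_moment:
  "(\<integral>U. (expval d L Ob v (tn_state D d L \<phi> U))\<^sup>2 \<partial>(\<Pi>\<^sub>M u\<in>S. \<mu>)) =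
    of_real (\<Sum>K\<in>Pow S. \<Prod>u\<in>S. site_weight u (u \<in> K) (up L u \<in> K) (right L u \<in> K))"
proof -
  have "(\<Prod>u\<in>S. \<Sum>s\<in>UNIV. \<Sum>t\<in>UNIV. gate_weight x1 x2 x3 bond_dim_power u s t) =
      (\<Sum>K\<in>Pow S. \<Sum>J\<in>Pow S. \<Prod>u\<in>S. gate_weight x1 x2 x3 bond_dim_power u (u \<in> K) (u \<in> J))" for x1 x2 x3 bond_dim_power
    by (simp only: prod_sum_bool finite_sites)
  then have "(\<integral>U. (expval d L Ob v (tn_state D d L \<phi> U))\<^sup>2 \<partial>(\<Pi>\<^sub>M u\<in>S. \<mu>)) =
      (\<Sum>K\<in>Pow S. \<Sum>J\<in>Pow S. qsum (S \<rightarrow>\<^sub>E X) (\<lambda>x1 x2 x3 bond_dim_power. \<Prod>u\<in>S. gate_weight x1 x2 x3 bond_dim_power u (u \<in> K) (u \<in> J)))"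
    unfolding integral_expval_square(2) by (simp only: qsum_sum)
  also have "\<dots> = of_real (\<Sum>K\<in>Pow S. \<Sum>J\<in>Pow S. \<Prod>u\<in>S. weingarten (D * D * d) (u \<in> K) (u \<in> J) *
      loop_weight D (up L u \<in> K) (u \<in> J) * loop_weight D (right L u \<in> K) (u \<in> J) * phys_weight u (u \<in> J))"
    unfolding qsum_gate_weight of_real_sum ..
  \<comment> \<open>For fixed K the output permutations J are independent across sites, so their sum
    moves inside the product.\<close>
  also have "\<dots> = of_real (\<Sum>K\<in>Pow S. \<Prod>u\<in>S. site_weight u (u \<in> K) (up L u \<in> K) (right L u \<in> K))"
    unfolding site_weight_def
    by (subst prod_sum_bool[OF finite_sites, of "\<lambda>u t. weingarten (D * D * d) (u \<in> K) t *
      loop_weight D (up L u \<in> K) t * loop_weight D (right L u \<in> K) t * phys_weight u t" for K]) (rule refl)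
  finally show ?thesis .
qed

end

subsection \<open>Bulk weights and the tail bound\<close>

definition bulk_weight :: "nat \<Rightarrow> nat \<Rightarrow> bool \<Rightarrow> bool \<Rightarrow> bool \<Rightarrow> real" where
  "bulk_weight D d s p r = (\<Sum>t\<in>UNIV. weingarten (D * D * d) s t * loop_weight D p t * loop_weight D r t *
     (if t then real d else (real d)\<^sup>2))"

context
  fixes D d :: nat and x y :: real
  assumes D: "D \<ge> 2" and d: "d \<ge> 2"
  defines "x \<equiv> real D" and "y \<equiv> real d"
begin

lemma dims_ge_2: "x \<ge> 2" "y \<ge> 2"
  using D d by (simp_all add: x_def y_def)

lemma bond_dim_power: "x ^ 4 \<ge> 16" and phys_dim_power: "y\<^sup>2 \<ge> 4"
  using power_mono[OF dims_ge_2(1), of 4] power_mono[OF dims_ge_2(2), of 2] by simp_all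

lemma weingarten_denom: "3 * x ^ 4 \<le> x ^ 4 * y\<^sup>2 - 1" "0 < x ^ 4 * y\<^sup>2 - 1"
proof -
  have "x ^ 4 * 4 \<le> x ^ 4 * y\<^sup>2" using bond_dim_power phys_dim_power by (intro mult_left_mono) auto
  then show "3 * x ^ 4 \<le> x ^ 4 * y\<^sup>2 - 1" using bond_dim_power by linarith
  then show "0 < x ^ 4 * y\<^sup>2 - 1" using bond_dim_power by linarith
qed

lemma weingarten_eq: "weingarten (D * D * d) s t = (if s = t then 1 else - 1 / (x\<^sup>2 * y)) / (x ^ 4 * y\<^sup>2 - 1)"
  by (simp add: weingarten_def x_def y_def power_mult_distrib power2_eq_square power4_eq_xxxx)

text \<open>The first two values express that Weingarten coefficients invert the Gram matrix: with
  identity neighbours the remaining factor is the loop weight of t with the identity in dimension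
  D^2 d.\<close>

lemma bulk_weight_eq:
  "bulk_weight D d False False False = 1"
  "bulk_weight D d True False False = 0"
  "bulk_weight D d False True True = (x\<^sup>2 * (y\<^sup>2 - 1)) / (x ^ 4 * y\<^sup>2 - 1)"
  "bulk_weight D d True True True = (y * (x ^ 4 - 1)) / (x ^ 4 * y\<^sup>2 - 1)"
  "p \<noteq> r \<Longrightarrow> bulk_weight D d False p r = (x * (x\<^sup>2 * y\<^sup>2 - 1)) / (x ^ 4 * y\<^sup>2 - 1)"
  "p \<noteq> r \<Longrightarrow> bulk_weight D d True p r = (x * y * (x\<^sup>2 - 1)) / (x ^ 4 * y\<^sup>2 - 1)"
proof -
  define l where "l p t = (if p = t then x\<^sup>2 else x)" for p t :: bool
  define e where "e = - 1 / (x\<^sup>2 * y)"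
  define m where "m = x ^ 4 * y\<^sup>2 - 1"
  \<comment> \<open>Multiplication by e removes a factor x^2 y and flips the sign; the numbered
    facts apply this to the off-diagonal term of each neighbour pattern.\<close>
  have e: "e * z = - c" if "z = x\<^sup>2 * y * c" for z c using that dims_ge_2 by (simp add: e_def)
  have m: "m \<noteq> 0" using weingarten_denom(2) by (simp add: m_def)
  have lw: "loop_weight D p t = l p t" for p t by (simp add: loop_weight_def l_def x_def)
  have wg: "weingarten (D * D * d) s t = (if s = t then 1 else e) / m" for s t
    by (simp add: weingarten_eq e_def m_def)
  have wF: "bulk_weight D d False p r = (l p False * l r False * y\<^sup>2 + e * (l p True * l r True * y)) / m"
    and wT: "bulk_weight D d True p r = (e * (l p False * l r False * y\<^sup>2) + l p True * l r True * y) / m" for p r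
    unfolding bulk_weight_def lw wg UNIV_bool y_def[symmetric] by (simp_all add: add_divide_distrib mult.assoc)
  have 1: "e * (l False True * l False True * y) = - 1"
    by (rule e) (simp add: l_def power2_eq_square)
  have 2: "e * (l False False * l False False * y\<^sup>2) = - (x\<^sup>2 * y)"
    by (rule e) (simp add: l_def power2_eq_square)
  have 3: "e * (l True True * l True True * y) = - (x\<^sup>2)"
    by (rule e) (simp add: l_def power2_eq_square)
  have 4: "e * (l True False * l True False * y\<^sup>2) = - y"
    by (rule e) (simp add: l_def power2_eq_square)
  have 5: "e * (l p True * l r True * y) = - x" if "p \<noteq> r" for p r
    by (rule e) (use that in \<open>auto simp: l_def power2_eq_square\<close>)
  have 6: "e * (l p False * l r False * y\<^sup>2) = - (x * y)" if "p \<noteq> r" for p r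
    by (rule e) (use that in \<open>auto simp: l_def power2_eq_square\<close>)
  show "bulk_weight D d False False False = 1"
    unfolding wF 1 using m by (simp add: l_def m_def power2_eq_square power4_eq_xxxx mult_ac)
  show "bulk_weight D d True False False = 0"
    unfolding wT 2 by (simp add: l_def power2_eq_square)
  show "bulk_weight D d False True True = (x\<^sup>2 * (y\<^sup>2 - 1)) / (x ^ 4 * y\<^sup>2 - 1)"
    unfolding wF 3 by (simp add: l_def m_def power2_eq_square algebra_simps)
  show "bulk_weight D d True True True = (y * (x ^ 4 - 1)) / (x ^ 4 * y\<^sup>2 - 1)"
    unfolding wT 4 by (simp add: l_def m_def power2_eq_square power4_eq_xxxx algebra_simps)
  show "bulk_weight D d False p r = (x * (x\<^sup>2 * y\<^sup>2 - 1)) / (x ^ 4 * y\<^sup>2 - 1)" if "p \<noteq> r"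
    unfolding wF 5[OF that] m_def[symmetric] using that by (auto simp: l_def algebra_simps)
  show "bulk_weight D d True p r = (x * y * (x\<^sup>2 - 1)) / (x ^ 4 * y\<^sup>2 - 1)" if "p \<noteq> r"
    unfolding wT 6[OF that] m_def[symmetric] using that by (auto simp: l_def algebra_simps)
qed

lemma bulk_weight_nonneg: "0 \<le> bulk_weight D d s p r"
proof -
  have "x\<^sup>2 * y\<^sup>2 \<ge> 1" "x\<^sup>2 \<ge> 1"
    using dims_ge_2 by (auto simp: power_mult_distrib[symmetric] intro!: one_le_power mult_ge1_I)
  then have "0 \<le> x\<^sup>2 * (y\<^sup>2 - 1)" "0 \<le> y * (x ^ 4 - 1)" "0 \<le> x * (x\<^sup>2 * y\<^sup>2 - 1)" "0 \<le> x * y * (x\<^sup>2 - 1)"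
    using dims_ge_2 bond_dim_power phys_dim_power by simp_all
  then show ?thesis
    using weingarten_denom(2) by (cases s; cases p; cases r; simp add: bulk_weight_eq)
qed

text \<open>The numerators add up to a multiple of x^2 y - 1, which cancels one factor of the
  denominator x^4 y^2 - 1. The same happens when both neighbours are swapped.\<close>

lemma bulk_weight_mixed_eq:
  assumes "p \<noteq> r"
  shows "bulk_weight D d True p r + bulk_weight D d False p r = x * (y + 1) / (x\<^sup>2 * y + 1)"
proof -
  have "4 * 2 \<le> x\<^sup>2 * y" using power_mono[OF dims_ge_2(1), of 2] dims_ge_2 by (intro mult_mono) auto
  then have pos: "x\<^sup>2 * y + 1 > 0" "x\<^sup>2 * y - 1 \<noteq> 0" by auto
  have "x ^ 4 * y\<^sup>2 - 1 = (x\<^sup>2 * y - 1) * (x\<^sup>2 * y + 1)"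
    by (simp add: algebra_simps power2_eq_square power4_eq_xxxx)
  moreover have "(x * y * (x\<^sup>2 - 1)) + (x * (x\<^sup>2 * y\<^sup>2 - 1)) = (x\<^sup>2 * y - 1) * (x * (y + 1))"
    by (simp add: algebra_simps power2_eq_square)
  ultimately show ?thesis
    using pos by (simp add: bulk_weight_eq assms add_divide_distrib[symmetric])
qed

lemma bulk_weight_both_eq:
  "bulk_weight D d True True True + bulk_weight D d False True True = (y + x\<^sup>2) / (x\<^sup>2 * y + 1)"
proof -
  have "4 * 2 \<le> x\<^sup>2 * y" using power_mono[OF dims_ge_2(1), of 2] dims_ge_2 by (intro mult_mono) auto
  then have pos: "x\<^sup>2 * y + 1 > 0" "x\<^sup>2 * y - 1 \<noteq> 0" by auto
  have "x ^ 4 * y\<^sup>2 - 1 = (x\<^sup>2 * y - 1) * (x\<^sup>2 * y + 1)"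
    by (simp add: algebra_simps power2_eq_square power4_eq_xxxx)
  moreover have "y * (x ^ 4 - 1) + x\<^sup>2 * (y\<^sup>2 - 1) = (x\<^sup>2 * y - 1) * (y + x\<^sup>2)"
    by (simp add: algebra_simps power2_eq_square power4_eq_xxxx)
  ultimately show ?thesis
    using pos by (simp add: bulk_weight_eq add_divide_distrib[symmetric])
qed

lemma bulk_weight_mixed:
  assumes "p \<noteq> r"
  shows "bulk_weight D d True p r + bulk_weight D d False p r \<le> 2 / 3"
    and "bulk_weight D d True p r + bulk_weight D d False p r \<le> 3 / (2 * x)"
proof -
  have "x\<^sup>2 * y > 0" using dims_ge_2 by simp
  then have pos: "x\<^sup>2 * y + 1 > 0" by simp
  \<comment> \<open>The difference of the sides of the cleared inequality is its value (4x - 1)(x -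
    2) at y = 2 plus (y - 2) x (2x - 3); it vanishes at x = y = 2.\<close>
  have "0 \<le> (4 * x - 1) * (x - 2)" using dims_ge_2 by simp
  moreover have "0 \<le> (y - 2) * (x * (2 * x - 3))" using dims_ge_2 by simp
  ultimately have "3 * (x * (y + 1)) \<le> 2 * (x\<^sup>2 * y + 1)"
    by (simp add: algebra_simps power2_eq_square)
  then show "bulk_weight D d True p r + bulk_weight D d False p r \<le> 2 / 3"
    unfolding bulk_weight_mixed_eq[OF assms] using pos by (simp add: divide_le_eq)
  \<comment> \<open>Here the cleared difference is x^2 (y - 2) + 3.\<close>
  have "0 \<le> x\<^sup>2 * (y - 2)" using dims_ge_2 by simp
  then have "x * (y + 1) * (2 * x) \<le> 3 * (x\<^sup>2 * y + 1)"
    by (simp add: algebra_simps power2_eq_square)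
  then show "bulk_weight D d True p r + bulk_weight D d False p r \<le> 3 / (2 * x)"
    unfolding bulk_weight_mixed_eq[OF assms] using pos dims_ge_2 by (subst frac_le_eq) (auto simp: divide_le_0_iff)
qed

lemma bulk_weight_both: "bulk_weight D d True True True + bulk_weight D d False True True \<le> 2 / 3"
proof -
  have "x\<^sup>2 * y > 0" using dims_ge_2 by simp
  then have pos: "x\<^sup>2 * y + 1 > 0" by simp
  have "x\<^sup>2 \<ge> 4" using power_mono[OF dims_ge_2(1), of 2] by simp
  \<comment> \<open>The cleared difference is x^2 - 4, its value at y = 2, plus this
    product.\<close>
  then have "0 \<le> (y - 2) * (2 * x\<^sup>2 - 3)" using dims_ge_2 by simp
  then have "3 * (y + x\<^sup>2) \<le> 2 * (x\<^sup>2 * y + 1)"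
    using \<open>x\<^sup>2 \<ge> 4\<close> by (simp add: algebra_simps)
  then show ?thesis
    unfolding bulk_weight_both_eq using pos by (simp add: divide_le_eq)
qed

lemma percolation_bulk_weight:
  assumes "L \<ge> 3"
  shows "percolation L (bulk_weight D d) (3 / (2 * x))"
proof
  show "bulk_weight D d True p q + bulk_weight D d False p q \<le> 2 / 3" if "p \<or> q" for p q
    using that bulk_weight_mixed(1)[of p q] bulk_weight_both by (cases "p = q") auto
  show "bulk_weight D d True p q + bulk_weight D d False p q \<le> 3 / (2 * x)" if "p \<noteq> q" for p q
    by (rule bulk_weight_mixed(2)[OF that])
qed (use assms dims_ge_2 in \<open>simp_all add: bulk_weight_nonneg bulk_weight_eq(1,2)\<close>)

end

text \<open>The last factor behaves like L (2/3)^L, so the whole is of order L^2 (2/3)^L.\<close>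

lemma winding_tendsto_0:
  "(\<lambda>L. 3 / 2 * real L * ((1 + (2 / 3) ^ L) ^ L - 1)) \<longlonglongrightarrow> 0"
  by real_asymp

section \<open>The weight at the observable and the tail bound\<close>

context random_tn
begin

lemma site_weight_bulk: "u \<noteq> v \<Longrightarrow> site_weight u = bulk_weight D d"
  by (intro ext) (simp add: site_weight_def bulk_weight_def phys_weight_def)

definition source_weight :: "bool \<Rightarrow> bool \<Rightarrow> real" where
  "source_weight p r = ob_norm * (loop_weight D p True * loop_weight D r True / (real D ^ 4 * (real d)\<^sup>2 - 1))"

text \<open>As (Tr O)^2 = 0, only the swap output survives at v. With swap input its Weingarten
  coefficient is the positive diagonal one, with identity input the negative off-diagonal
  one.\<close>

lemma site_weight_source:
  "site_weight v True p r = source_weight p r" "site_weight v False p r \<le> 0"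
proof -
  note pos = weingarten_denom(2)[OF D d]
  show "site_weight v True p r = source_weight p r"
    by (simp add: site_weight_def source_weight_def phys_weight_def weingarten_eq[OF D d] UNIV_bool)
  have "0 \<le> loop_weight D p True * loop_weight D r True * ob_norm"
    using ob_norm_nonneg by (simp add: loop_weight_def)
  then have "(- 1 / ((real D)\<^sup>2 * real d)) / (real D ^ 4 * (real d)\<^sup>2 - 1) * (loop_weight D p True * loop_weight D r True * ob_norm) \<le> 0"
    using pos D d by (intro mult_nonpos_nonneg divide_nonpos_pos) auto
  then show "site_weight v False p r \<le> 0"
    unfolding site_weight_def weingarten_eq[OF D d] UNIV_bool by (simp add: phys_weight_def mult.assoc)
qed

text \<open>The denominator is at least 3 D^4. The two bond loops give at most D^2 each, and only D
  each when both neighbours are in the identity state; this is the gain of D^-2 at v.\<close>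

lemma source_weight_bounds:
  "0 \<le> source_weight p r" "source_weight p r \<le> ob_norm * (1 / 3)"
  "source_weight False False \<le> ob_norm * (1 / (3 * (real D)\<^sup>2))"
proof -
  have D1: "1 \<le> real D" using D by simp
  have m: "3 * real D ^ 4 \<le> real D ^ 4 * (real d)\<^sup>2 - 1" "0 < real D ^ 4 * (real d)\<^sup>2 - 1"
    using weingarten_denom[OF D d] by auto
  show "0 \<le> source_weight p r"
    unfolding source_weight_def using ob_norm_nonneg m(2)
    by (intro mult_nonneg_nonneg divide_nonneg_pos) (auto simp: loop_weight_def)
  have l: "0 \<le> loop_weight D p True" "loop_weight D p True \<le> (real D)\<^sup>2" for p
    using D1 by (auto simp: loop_weight_def power2_eq_square)
  have "loop_weight D p True * loop_weight D r True \<le> (real D)\<^sup>2 * (real D)\<^sup>2"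
    by (intro mult_mono l) auto
  then have "3 * (loop_weight D p True * loop_weight D r True) \<le> real D ^ 4 * (real d)\<^sup>2 - 1"
    using m(1) by (simp add: power2_eq_square power4_eq_xxxx)
  then have "loop_weight D p True * loop_weight D r True / (real D ^ 4 * (real d)\<^sup>2 - 1) \<le> 1 / 3"
    using m(2) by (simp add: divide_le_eq)
  then show "source_weight p r \<le> ob_norm * (1 / 3)"
    unfolding source_weight_def by (intro mult_left_mono ob_norm_nonneg)
  have "3 * (real D)\<^sup>2 * (real D)\<^sup>2 \<le> real D ^ 4 * (real d)\<^sup>2 - 1"
    using m(1) by (simp add: power2_eq_square power4_eq_xxxx)
  then have "(real D)\<^sup>2 / (real D ^ 4 * (real d)\<^sup>2 - 1) \<le> 1 / (3 * (real D)\<^sup>2)"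
    using m(2) D1 by (simp add: divide_simps mult_ac)
  then show "source_weight False False \<le> ob_norm * (1 / (3 * (real D)\<^sup>2))"
    unfolding source_weight_def
    by (intro mult_left_mono ob_norm_nonneg) (simp add: loop_weight_def power2_eq_square)
qed

lemma second_moment_le:
  assumes L: "L \<ge> 3" and small: "3 / 2 * real L * ((1 + (2 / 3) ^ L) ^ L - 1) \<le> 1 / real D ^ 4"
  shows "(\<Sum>K\<in>Pow S. \<Prod>u\<in>S. site_weight u (u \<in> K) (up L u \<in> K) (right L u \<in> K)) \<le> 2 * (ob_norm / real D ^ 4)"
proof -
  note P = percolation_bulk_weight[OF D d L]
  define weight where "weight = percolation.weight L (bulk_weight D d)"
  let ?t = "\<lambda>K. \<Prod>u\<in>S. site_weight u (u \<in> K) (up L u \<in> K) (right L u \<in> K)"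
  have t: "?t K = site_weight v (v \<in> K) (up L v \<in> K) (right L v \<in> K) * (\<Prod>u\<in>S - {v}. weight u K)" for K
    unfolding prod.remove[OF finite_sites v]
    by (intro arg_cong2[where f = "(*)"] prod.cong refl) (auto simp: site_weight_bulk weight_def percolation.weight_def[OF P])
  have W0: "0 \<le> (\<Prod>u\<in>S - {v}. weight u K)" for K
    unfolding weight_def by (intro prod_nonneg ballI percolation.weight_nonneg[OF P])
  \<comment> \<open>Configurations without v contribute a nonpositive source factor times
    nonnegative weights and are dropped.\<close>
  have "(\<Sum>K\<in>Pow S. ?t K) \<le> (\<Sum>K\<in>Pow S. if v \<in> K then source_weight (up L v \<in> K) (right L v \<in> K) * (\<Prod>u\<in>S - {v}. weight u K) else 0)"
    using W0 by (intro sum_mono) (auto simp: t site_weight_source intro!: mult_nonpos_nonneg)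
  also have "\<dots> = (\<Sum>K\<in>{K \<in> Pow S. v \<in> K}. source_weight (up L v \<in> K) (right L v \<in> K) * (\<Prod>u\<in>S - {v}. weight u K))"
    by (intro sum.inter_filter[symmetric]) simp
  also have "\<dots> \<le> ob_norm * (1 / (3 * (real D)\<^sup>2)) * (3 / (2 * real D))\<^sup>2 +
      ob_norm * (1 / 3) * (3 / 2 * real L * ((1 + (2 / 3) ^ L) ^ L - 1))"
    unfolding weight_def by (rule percolation.sum_weight_le[OF P v, of source_weight]) (rule source_weight_bounds)+
  also have "\<dots> \<le> ob_norm * (1 / (3 * (real D)\<^sup>2)) * (3 / (2 * real D))\<^sup>2 + ob_norm * (1 / 3) * (1 / real D ^ 4)"
    using ob_norm_nonneg by (intro add_left_mono mult_left_mono small) auto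
  \<comment> \<open>13/12 = 3/4 + 1/3, where 3/4 comes from (1/3) (3/2)^2 and 1/3 from the winding
    term; it is then rounded up to 2.\<close>
  also have "\<dots> = (13 / 12) * (ob_norm / real D ^ 4)"
    using D by (simp add: field_simps power2_eq_square power4_eq_xxxx)
  also have "\<dots> \<le> 2 * (ob_norm / real D ^ 4)"
    using ob_norm_nonneg by (intro mult_right_mono) auto
  finally show ?thesis .
qed

lemma expval_tail:
  assumes L: "L \<ge> 3" and small: "3 / 2 * real L * ((1 + (2 / 3) ^ L) ^ L - 1) \<le> 1 / real D ^ 4" and \<epsilon>: "\<epsilon> > 0"
  shows "measure (\<Pi>\<^sub>M u\<in>S. \<mu>) {U \<in> space (\<Pi>\<^sub>M u\<in>S. \<mu>). cmod (expval d L Ob v (tn_state D d L \<phi> U)) \<ge> \<epsilon>}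
    \<le> 2 * (Re (mat_trace (Ob * Ob)) / real D ^ 4 / \<epsilon>\<^sup>2)"
proof -
  let ?M = "\<Pi>\<^sub>M u\<in>S. \<mu>"
  define z where "z U = expval d L Ob v (tn_state D d L \<phi> U)" for U
  have norm: "(cmod (z U))\<^sup>2 = Re ((z U)\<^sup>2)" for U
  proof -
    have "complex_of_real ((cmod (z U))\<^sup>2) = (z U)\<^sup>2"
      unfolding complex_norm_square using cnj_expval[of U] by (simp add: z_def power2_eq_square)
    then show ?thesis by (metis Re_complex_of_real)
  qed
  have int: "integrable ?M (\<lambda>U. (z U)\<^sup>2)" unfolding z_def by (rule integral_expval_square(1))
  have "{U \<in> space ?M. cmod (z U) \<ge> \<epsilon>} = {U \<in> space ?M. \<epsilon>\<^sup>2 \<le> Re ((z U)\<^sup>2)}"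
    using \<epsilon> by (auto simp: norm[symmetric] abs_le_square_iff[symmetric])
  then have "measure ?M {U \<in> space ?M. cmod (z U) \<ge> \<epsilon>} \<le> (\<integral>U. Re ((z U)\<^sup>2) \<partial>?M) / \<epsilon>\<^sup>2"
    using integral_Markov_inequality_measure[OF integrable_Re[OF int] sets.empty_sets, of "\<epsilon>\<^sup>2"] \<epsilon>
    by (simp add: norm[symmetric] del: Re_power2)
  also have "(\<integral>U. Re ((z U)\<^sup>2) \<partial>?M) = Re (\<integral>U. (z U)\<^sup>2 \<partial>?M)"
    by (rule integral_Re[OF int])
  also have "\<dots> = (\<Sum>K\<in>Pow S. \<Prod>u\<in>S. site_weight u (u \<in> K) (up L u \<in> K) (right L u \<in> K))"
    unfolding z_def second_moment by (rule Re_complex_of_real)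
  also have "\<dots> / \<epsilon>\<^sup>2 \<le> 2 * (ob_norm / real D ^ 4) / \<epsilon>\<^sup>2"
    by (intro divide_right_mono second_moment_le L small) simp
  finally show ?thesis by (simp add: z_def ob_norm_def)
qed

end

theorem theorem4:
  fixes d :: nat
  assumes "d \<ge> 2"
  shows "\<exists>C::real. C > 0 \<and> (\<forall>D\<ge>2. \<exists>L0. \<forall>L\<ge>L0. \<forall>\<mu> \<phi> Ob. \<forall>v\<in>sites L. \<forall>\<epsilon>::real.
     haar_unitary (D * D * d) \<mu> \<longrightarrow>
     \<phi> \<in> carrier_vec d \<longrightarrow> \<phi> \<bullet>c \<phi> = 1 \<longrightarrow>
     Ob \<in> carrier_mat d d \<longrightarrow> hermitian_mat Ob \<longrightarrow> mat_trace Ob = 0 \<longrightarrow>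
     \<epsilon> > 0 \<longrightarrow>
     measure (\<Pi>\<^sub>M u\<in>sites L. \<mu>)
       {U \<in> space (\<Pi>\<^sub>M u\<in>sites L. \<mu>). cmod (expval d L Ob v (tn_state D d L \<phi> U)) \<ge> \<epsilon>}
     \<le> C * (Re (mat_trace (Ob * Ob)) / real D ^ 4 / \<epsilon>\<^sup>2))"
proof (intro exI[of _ "2::real"] conjI allI impI)
  fix D :: nat assume D: "2 \<le> D"
  \<comment> \<open>The threshold on L is fixed here and depends on D alone, since the winding bound
    involves only L and the constant 2/3.\<close>
  have "\<forall>\<^sub>F L in sequentially. 3 / 2 * real L * ((1 + (2 / 3) ^ L) ^ L - 1) < 1 / real D ^ 4"
    using D by (intro order_tendstoD(2)[OF winding_tendsto_0]) simp
  then obtain L1 where L1: "\<And>L. L \<ge> L1 \<Longrightarrow> 3 / 2 * real L * ((1 + (2 / 3) ^ L) ^ L - 1) < 1 / real D ^ 4"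
    by (auto simp: eventually_sequentially)
  show "\<exists>L0. \<forall>L\<ge>L0. \<forall>\<mu> \<phi> Ob. \<forall>v\<in>sites L. \<forall>\<epsilon>::real.
     haar_unitary (D * D * d) \<mu> \<longrightarrow>
     \<phi> \<in> carrier_vec d \<longrightarrow> \<phi> \<bullet>c \<phi> = 1 \<longrightarrow>
     Ob \<in> carrier_mat d d \<longrightarrow> hermitian_mat Ob \<longrightarrow> mat_trace Ob = 0 \<longrightarrow>
     \<epsilon> > 0 \<longrightarrow>
     measure (\<Pi>\<^sub>M u\<in>sites L. \<mu>)
       {U \<in> space (\<Pi>\<^sub>M u\<in>sites L. \<mu>). cmod (expval d L Ob v (tn_state D d L \<phi> U)) \<ge> \<epsilon>}
     \<le> 2 * (Re (mat_trace (Ob * Ob)) / real D ^ 4 / \<epsilon>\<^sup>2)"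
  proof (intro exI[of _ "max 3 L1"] allI impI ballI)
    fix L \<mu> and \<phi> :: "complex Matrix.vec" and Ob v and \<epsilon> :: real
    assume L: "max 3 L1 \<le> L" and v: "v \<in> sites L" and \<mu>: "haar_unitary (D * D * d) \<mu>"
      and \<phi>: "\<phi> \<in> carrier_vec d" "\<phi> \<bullet>c \<phi> = 1"
      and Ob: "Ob \<in> carrier_mat d d" "hermitian_mat Ob" "mat_trace Ob = 0" and \<epsilon>: "0 < \<epsilon>"
    interpret prob_space \<mu> using \<mu> by (simp add: haar_unitary_def)
    interpret random_tn \<mu> D d L \<phi> Ob v
      by unfold_locales (fact \<mu> D assms \<phi> Ob v)+
    show "measure (\<Pi>\<^sub>M u\<in>sites L. \<mu>)
       {U \<in> space (\<Pi>\<^sub>M u\<in>sites L. \<mu>). cmod (expval d L Ob v (tn_state D d L \<phi> U)) \<ge> \<epsilon>}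
     \<le> 2 * (Re (mat_trace (Ob * Ob)) / real D ^ 4 / \<epsilon>\<^sup>2)"
      using L L1[of L] \<epsilon> by (intro expval_tail) auto
  qed
qed simp

end
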